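(* Let $A\subseteq B$ be an extension of commutative rings, and let $\phi:B\to B_{\mathrm{red}}$ be the canonical surjection (so $\phi(A)=A_{\mathrm{red}}\subseteq B_{\mathrm{red}}$). Then the group morphism $\mathfrak{C}(A,B)\to \mathfrak{C}(A_{\mathrm{red}},B_{\mathrm{red}})$ induced by $L\mapsto \phi(L)A_{\mathrm{red}}$ is an isomorphism.
   Context: All rings are commutative with identity; $R_{\mathrm{red}}$ is $R$ modulo its nilradical. For an extension of rings $R\subseteq S$ and $R$-submodules $L,L'$ of $S$, $LL'$ is the $R$-submodule of finite sums $\sum x_ky_k$ with $x_k\in L, y_k\in L'$. An $R$-submodule $L$ of $S$ is an invertible ideal of $R\subseteq S$ if $LL'=R$ for some $R$-submodule $L'$ of $S$; these form an abelian group $\mathscr{G}(R,S)$ under multiplication, and the ideal class group is $\mathfrak{C}(R,S)=\mathscr{G}(R,S)/\{Rx : x\in S^\ast\}$. *)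

theory Defs
  imports "HOL-Algebra.Algebra"
begin

text \<open>Ring extension A \<subseteq> carrier R (A a subring of the commutative ring R).
  An A-submodule of R: a subset containing zero, closed under addition and under
  multiplication by elements of A.\<close>
definition submod :: "('a, 'b) ring_scheme \<Rightarrow> 'a set \<Rightarrow> 'a set \<Rightarrow> bool" where
  "submod R A L \<longleftrightarrow> L \<subseteq> carrier R \<and> \<zero>\<^bsub>R\<^esub> \<in> L
     \<and> (\<forall>x\<in>L. \<forall>y\<in>L. x \<oplus>\<^bsub>R\<^esub> y \<in> L)
     \<and> (\<forall>a\<in>A. \<forall>x\<in>L. a \<otimes>\<^bsub>R\<^esub> x \<in> L)"

definition ideal_mult :: "('a, 'b) ring_scheme \<Rightarrow> 'a set \<Rightarrow> 'a set \<Rightarrow> 'a set" where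
  "ideal_mult R L L' = {finsum R (\<lambda>i. f i \<otimes>\<^bsub>R\<^esub> g i) {..<n::nat} | n f g.
       \<forall>i<n. f i \<in> L \<and> g i \<in> L'}"

definition invertible_ideal :: "('a, 'b) ring_scheme \<Rightarrow> 'a set \<Rightarrow> 'a set \<Rightarrow> bool" where
  "invertible_ideal R A L \<longleftrightarrow> submod R A L \<and> (\<exists>L'. submod R A L' \<and> ideal_mult R L L' = A)"

definition inv_ideal_group :: "('a, 'b) ring_scheme \<Rightarrow> 'a set \<Rightarrow> 'a set monoid" where
  "inv_ideal_group R A = \<lparr>carrier = {L. invertible_ideal R A L}, monoid.mult = ideal_mult R, one = A\<rparr>"

definition principal_ideals :: "('a, 'b) ring_scheme \<Rightarrow> 'a set \<Rightarrow> 'a set set" where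
  "principal_ideals R A = {(\<lambda>a. a \<otimes>\<^bsub>R\<^esub> x) ` A | x. x \<in> Units R}"

definition class_group :: "('a, 'b) ring_scheme \<Rightarrow> 'a set \<Rightarrow> 'a set set monoid" where
  "class_group R A = inv_ideal_group R A Mod principal_ideals R A"

definition ideal_class :: "('a, 'b) ring_scheme \<Rightarrow> 'a set \<Rightarrow> 'a set \<Rightarrow> 'a set set" where
  "ideal_class R A L = principal_ideals R A #>\<^bsub>inv_ideal_group R A\<^esub> L"

definition nilradical :: "('a, 'b) ring_scheme \<Rightarrow> 'a set" where
  "nilradical R = {x \<in> carrier R. \<exists>n::nat. x [^]\<^bsub>R\<^esub> n = \<zero>\<^bsub>R\<^esub>}"

definition red :: "('a, 'b) ring_scheme \<Rightarrow> 'a set ring" where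
  "red R = R Quot nilradical R"

definition red_map :: "('a, 'b) ring_scheme \<Rightarrow> 'a \<Rightarrow> 'a set" where
  "red_map R x = nilradical R +>\<^bsub>R\<^esub> x"

end

theory Submission
  imports Defs
begin

text \<open>
  The map \<open>L \<mapsto> \<phi>(L)\<close> is a homomorphism of groups of invertible ideals for every surjection \<open>\<phi>\<close>
  with nil kernel. It is injective modulo principal ideals because units lift: if \<open>\<phi>(L)\<close> is generated
  by the unit \<open>y\<close> and \<open>l \<in> L\<close>, \<open>l' \<in> L\<inverse>\<close> lie over \<open>y\<close> and \<open>y\<inverse>\<close>, then \<open>ll'\<close> is a unit of \<open>A\<close>
  and every \<open>z \<in> L\<close> is \<open>(zl')(ll')\<inverse>l\<close>.

  For surjectivity let \<open>JJ' = \<phi>(A)\<close> and \<open>1 = \<Sum> x\<^sub>i y\<^sub>i\<close> with \<open>x\<^sub>i \<in> J\<close>, \<open>y\<^sub>i \<in> J'\<close>. The matrix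
  \<open>(y\<^sub>i x\<^sub>j)\<close> over \<open>\<phi>(A)\<close> is idempotent; finitely many nilpotents generate a nilpotent ideal, so it
  lifts to an idempotent matrix \<open>E\<close> over \<open>A\<close>. For lifts \<open>b\<close>, \<open>c\<close> of the row \<open>x\<close> and the column \<open>y\<close>,
  put \<open>b' = bE\<close> and let \<open>c'\<close> be \<open>Ec\<close> divided by the unit \<open>bEc\<close>. Then \<open>c'b'\<close> is an idempotent below
  \<open>E\<close>, and \<open>E - c'b'\<close> is both idempotent and nilpotent, so \<open>c'b' = E\<close> has entries in \<open>A\<close>. Hence the
  entries of \<open>b'\<close> span an invertible ideal over \<open>J\<close>, with inverse spanned by the entries of \<open>c'\<close>.
\<close>

section \<open>Invertible ideals\<close>

context cring
begin

lemma submodD: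
  assumes "submod R A L"
  shows "L \<subseteq> carrier R" "\<zero> \<in> L" "\<And>x y. \<lbrakk>x \<in> L; y \<in> L\<rbrakk> \<Longrightarrow> x \<oplus> y \<in> L"
    "\<And>a x. \<lbrakk>a \<in> A; x \<in> L\<rbrakk> \<Longrightarrow> a \<otimes> x \<in> L"
  using assms by (auto simp: submod_def)

lemma submod_finsum:
  assumes "submod R A L" "finite I" "\<And>i. i \<in> I \<Longrightarrow> f i \<in> L"
  shows "finsum R f I \<in> L"
  using assms(2,3)
proof (induction I rule: finite_induct)
  case empty
  then show ?case using submodD[OF assms(1)] by simp
next
  case (insert i I)
  then have "finsum R f (insert i I) = f i \<oplus> finsum R f I"
    using submodD(1)[OF assms(1)] by (intro finsum_insert) auto
  then show ?case using insert submodD(3)[OF assms(1)] by simp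
qed

lemma ideal_mult_zero: "\<zero> \<in> ideal_mult R L M"
  unfolding ideal_mult_def by (rule CollectI, rule exI[of _ 0]) simp

text \<open>A finite sum of products is built up one product at a time, which spares later proofs
  the indexed sums. Membership in the carrier is carried along because the ring laws applied in each
  step need it for the partial sum.\<close>

lemma ideal_mult_induct [consumes 3, case_names zero step]:
  assumes "s \<in> ideal_mult R L M" and "L \<subseteq> carrier R" and "M \<subseteq> carrier R"
    and zero: "P \<zero>"
    and step: "\<And>s x y. \<lbrakk>s \<in> carrier R; P s; x \<in> L; y \<in> M\<rbrakk> \<Longrightarrow> P (s \<oplus> x \<otimes> y)"
  shows "s \<in> carrier R \<and> P s"
proof -
  obtain n :: nat and f g where s: "s = finsum R (\<lambda>i. f i \<otimes> g i) {..<n}"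
    and fg: "\<forall>i<n. f i \<in> L \<and> g i \<in> M"
    using assms(1) unfolding ideal_mult_def by blast
  have "finsum R (\<lambda>i. f i \<otimes> g i) {..<k} \<in> carrier R \<and> P (finsum R (\<lambda>i. f i \<otimes> g i) {..<k})"
    if "k \<le> n" for k
    using that
  proof (induction k)
    case 0
    then show ?case using zero by simp
  next
    case (Suc k)
    have car: "f i \<otimes> g i \<in> carrier R" if "i < n" for i
      using fg that assms(2,3) by blast
    have "finsum R (\<lambda>i. f i \<otimes> g i) {..<Suc k} = f k \<otimes> g k \<oplus> finsum R (\<lambda>i. f i \<otimes> g i) {..<k}"
      unfolding lessThan_Suc using car Suc.prems by (intro finsum_insert) auto
    also have "\<dots> = finsum R (\<lambda>i. f i \<otimes> g i) {..<k} \<oplus> f k \<otimes> g k"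
      using car Suc by (intro a_comm) auto
    finally show ?case using Suc fg car by (auto intro!: step)
  qed
  then show ?thesis using s by blast
qed

text \<open>Introduction counterpart of the induction rule: the new product is stored at the free
  index \<open>n\<close> of the two families.\<close>

lemma ideal_mult_snoc:
  assumes "L \<subseteq> carrier R" "M \<subseteq> carrier R"
    and "s \<in> ideal_mult R L M" "x \<in> L" "y \<in> M"
  shows "s \<oplus> x \<otimes> y \<in> ideal_mult R L M"
proof -
  obtain n :: nat and f g where s: "s = finsum R (\<lambda>i. f i \<otimes> g i) {..<n}"
    and fg: "\<forall>i<n. f i \<in> L \<and> g i \<in> M"
    using assms(3) unfolding ideal_mult_def by blast
  let ?f = "f(n := x)" and ?g = "g(n := y)"
  have fgc: "f i \<in> carrier R" "g i \<in> carrier R" if "i < n" for i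
    using fg that assms(1,2) by auto
  have xyc: "x \<in> carrier R" "y \<in> carrier R" using assms by auto
  have "finsum R (\<lambda>i. ?f i \<otimes> ?g i) {..<Suc n}
      = ?f n \<otimes> ?g n \<oplus> finsum R (\<lambda>i. ?f i \<otimes> ?g i) {..<n}"
    unfolding lessThan_Suc by (intro finsum_insert) (use fgc xyc in auto)
  also have "finsum R (\<lambda>i. ?f i \<otimes> ?g i) {..<n} = s"
    unfolding s by (intro finsum_cong') (use fgc in auto)
  also have "s \<in> carrier R"
    unfolding s by (intro finsum_closed) (use fgc in auto)
  then have "?f n \<otimes> ?g n \<oplus> s = s \<oplus> x \<otimes> y"
    using xyc by (simp add: a_comm)
  finally have "s \<oplus> x \<otimes> y = finsum R (\<lambda>i. ?f i \<otimes> ?g i) {..<Suc n}" ..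
  moreover have "\<forall>i<Suc n. ?f i \<in> L \<and> ?g i \<in> M"
    using fg assms(4,5) by (auto simp: less_Suc_eq)
  ultimately show ?thesis unfolding ideal_mult_def by blast
qed

lemma ideal_mult_mem:
  assumes "L \<subseteq> carrier R" "M \<subseteq> carrier R" "x \<in> L" "y \<in> M"
  shows "x \<otimes> y \<in> ideal_mult R L M"
proof -
  have "x \<otimes> y \<in> carrier R" using assms by blast
  then show ?thesis
    using ideal_mult_snoc[OF assms(1,2) ideal_mult_zero assms(3,4)] by simp
qed

lemma ideal_mult_subset:
  assumes "L \<subseteq> carrier R" "M \<subseteq> carrier R" "submod R A N"
    and "\<And>x y. \<lbrakk>x \<in> L; y \<in> M\<rbrakk> \<Longrightarrow> x \<otimes> y \<in> N"
  shows "ideal_mult R L M \<subseteq> N"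
proof
  fix s assume "s \<in> ideal_mult R L M"
  then have "s \<in> carrier R \<and> s \<in> N" using assms(1,2)
    by (induction rule: ideal_mult_induct) (use assms(3,4) in \<open>auto dest: submodD\<close>)
  then show "s \<in> N" ..
qed

text \<open>Scalars are absorbed by the left factor, so the right one may be any subset of the ring.
  In particular, for a subring \<open>A\<close>, \<open>ideal_mult R A X\<close> is the
  \<open>A\<close>-span of a set \<open>X\<close>; lifted ideals are constructed later in this
  form.\<close>

lemma submod_ideal_mult:
  assumes A: "A \<subseteq> carrier R" and L: "submod R A L" and M: "M \<subseteq> carrier R"
  shows "submod R A (ideal_mult R L M)"
proof -
  note Lc = submodD(1)[OF L]
  have car: "s \<in> carrier R" if "s \<in> ideal_mult R L M" for s
    using ideal_mult_induct[OF that Lc M, of "\<lambda>_. True"] by blast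
  have "t \<in> carrier R \<and> s \<oplus> t \<in> ideal_mult R L M"
    if s: "s \<in> ideal_mult R L M" and "t \<in> ideal_mult R L M" for s t
    using that(2) Lc M
  proof (induction rule: ideal_mult_induct)
    case zero
    then show ?case using s car by simp
  next
    case (step t x y)
    have "s \<oplus> (t \<oplus> x \<otimes> y) = s \<oplus> t \<oplus> x \<otimes> y"
      by (intro a_assoc[symmetric]) (use step car s Lc M in auto)
    then show ?case using ideal_mult_snoc[OF Lc M] step by auto
  qed
  moreover have "s \<in> carrier R \<and> a \<otimes> s \<in> ideal_mult R L M"
    if a: "a \<in> A" and "s \<in> ideal_mult R L M" for s a
    using that(2) Lc M
  proof (induction rule: ideal_mult_induct)
    case zero
    then show ?case using a A ideal_mult_zero by (simp add: subset_iff)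
  next
    case (step t x y)
    have "a \<in> carrier R" "x \<in> carrier R" "y \<in> carrier R" using step Lc M a A by auto
    then have "a \<otimes> (t \<oplus> x \<otimes> y) = a \<otimes> t \<oplus> (a \<otimes> x) \<otimes> y"
      using step by (simp add: r_distr m_assoc)
    moreover have "a \<otimes> x \<in> L" using submodD(4)[OF L] a step by blast
    ultimately show ?case using ideal_mult_snoc[OF Lc M] step by auto
  qed
  ultimately show ?thesis
    unfolding submod_def using car ideal_mult_zero by blast
qed

lemma ideal_mult_commute:
  assumes "L \<subseteq> carrier R" "M \<subseteq> carrier R"
  shows "ideal_mult R L M = ideal_mult R M L"
proof -
  have "s \<in> ideal_mult R M' L'"
    if "s \<in> ideal_mult R L' M'" "L' \<subseteq> carrier R" "M' \<subseteq> carrier R" for L' M' s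
  proof -
    have "s \<in> carrier R \<and> s \<in> ideal_mult R M' L'"
      using that
    proof (induction rule: ideal_mult_induct)
      case zero
      then show ?case by (rule ideal_mult_zero)
    next
      case (step s x y)
      then have "x \<otimes> y = y \<otimes> x" using that by (intro m_comm) auto
      then show ?case using step ideal_mult_snoc[of M' L'] that by metis
    qed
    then show ?thesis ..
  qed
  then show ?thesis using assms by blast
qed

text \<open>Induction on the element of \<open>LM\<close> moves one bracket
  \<open>(xy)z = x(yz)\<close> at a time. Only this inclusion is proved directly, since
  commutativity yields the other.\<close>

lemma ideal_mult_assoc_subset:
  assumes A: "A \<subseteq> carrier R" and L: "submod R A L" and M: "submod R A M" and N: "submod R A N"
  shows "ideal_mult R (ideal_mult R L M) N \<subseteq> ideal_mult R L (ideal_mult R M N)"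
proof -
  note Lc = submodD(1)[OF L] and Mc = submodD(1)[OF M] and Nc = submodD(1)[OF N]
  note MN = submod_ideal_mult[OF A M Nc] and LM = submod_ideal_mult[OF A L Mc]
  note LMN = submod_ideal_mult[OF A L submodD(1)[OF MN]]
  show ?thesis
  proof (rule ideal_mult_subset[OF submodD(1)[OF LM] Nc LMN])
    fix t z assume t: "t \<in> ideal_mult R L M" and z: "z \<in> N"
    have "t \<in> carrier R \<and> t \<otimes> z \<in> ideal_mult R L (ideal_mult R M N)"
      using t Lc Mc
    proof (induction rule: ideal_mult_induct)
      case zero
      then show ?case using z Nc ideal_mult_zero by (simp add: subset_iff)
    next
      case (step s x y)
      have "x \<in> carrier R" "y \<in> carrier R" "z \<in> carrier R" using step z Lc Mc Nc by auto
      then have "(s \<oplus> x \<otimes> y) \<otimes> z = s \<otimes> z \<oplus> x \<otimes> (y \<otimes> z)"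
        using step by (simp add: l_distr m_assoc)
      moreover have "y \<otimes> z \<in> ideal_mult R M N"
        using ideal_mult_mem[OF Mc Nc] step z by blast
      ultimately show ?case
        using ideal_mult_snoc[OF Lc submodD(1)[OF MN]] step by auto
    qed
    then show "t \<otimes> z \<in> ideal_mult R L (ideal_mult R M N)" ..
  qed
qed

lemma ideal_mult_assoc:
  assumes A: "A \<subseteq> carrier R" and L: "submod R A L" and M: "submod R A M" and N: "submod R A N"
  shows "ideal_mult R (ideal_mult R L M) N = ideal_mult R L (ideal_mult R M N)"
proof
  note Lc = submodD(1)[OF L] and Mc = submodD(1)[OF M] and Nc = submodD(1)[OF N]
  note MN = submod_ideal_mult[OF A M Nc] and LM = submod_ideal_mult[OF A L Mc]
  \<comment> \<open>Reversing the order of the three factors turns the missing inclusion into the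
    one already shown.\<close>
  have "ideal_mult R L (ideal_mult R M N) = ideal_mult R (ideal_mult R N M) L"
    using ideal_mult_commute[OF Lc submodD(1)[OF MN]] ideal_mult_commute[OF Mc Nc] by simp
  also have "\<dots> \<subseteq> ideal_mult R N (ideal_mult R M L)"
    by (rule ideal_mult_assoc_subset[OF A N M L])
  also have "\<dots> = ideal_mult R (ideal_mult R L M) N"
    using ideal_mult_commute[OF submodD(1)[OF LM] Nc] ideal_mult_commute[OF Mc Lc] by simp
  finally show "ideal_mult R L (ideal_mult R M N) \<subseteq> ideal_mult R (ideal_mult R L M) N" .
qed (rule ideal_mult_assoc_subset[OF assms])

lemma subring_subset: "subring A R \<Longrightarrow> A \<subseteq> carrier R"
  by (rule subringE)

lemma submod_subring: "subring A R \<Longrightarrow> submod R A A"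
  unfolding submod_def using subringE[of A R] by auto

lemma ideal_mult_one:
  assumes A: "subring A R" and L: "submod R A L"
  shows "ideal_mult R L A = L" "ideal_mult R A L = L"
proof -
  note Lc = submodD(1)[OF L] and Ac = subring_subset[OF A]
  have "x \<otimes> a \<in> L" if "x \<in> L" "a \<in> A" for x a
    using submodD(4)[OF L that(2,1)] m_comm[of x a] that Lc Ac by (metis subsetD)
  then have "ideal_mult R L A \<subseteq> L" by (intro ideal_mult_subset[OF Lc Ac L]) auto
  moreover have "x \<in> ideal_mult R L A" if "x \<in> L" for x
    using ideal_mult_mem[OF Lc Ac that subringE(3)[OF A]] that Lc by (simp add: subset_iff)
  ultimately show "ideal_mult R L A = L" by blast
  then show "ideal_mult R A L = L" using ideal_mult_commute[OF Lc Ac] by simp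
qed

lemma inv_ideal_comm_group:
  assumes A: "subring A R"
  shows "comm_group (inv_ideal_group R A)"
proof -
  note Ac = subring_subset[OF A]
  \<comment> \<open>By commutativity the witness \<open>L'\<close> is itself invertible, so it
    belongs to the group and can serve there as the inverse.\<close>
  have inv: "invertible_ideal R A L'"
    if "submod R A L" "submod R A L'" "ideal_mult R L L' = A" for L L'
    unfolding invertible_ideal_def
    using that ideal_mult_commute[OF submodD(1)[OF that(2)] submodD(1)[OF that(1)]] by auto
  have closed: "invertible_ideal R A (ideal_mult R L M)"
    if LM: "invertible_ideal R A L" "invertible_ideal R A M" for L M
  proof -
    obtain L' M' where L: "submod R A L" and L': "submod R A L'" "ideal_mult R L L' = A"
      and M: "submod R A M" and M': "submod R A M'" "ideal_mult R M M' = A"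
      using LM unfolding invertible_ideal_def by blast
    note Lc = submodD(1)[OF L] and Mc = submodD(1)[OF M]
      and L'c = submodD(1)[OF L'(1)] and M'c = submodD(1)[OF M'(1)]
    note M'L' = submod_ideal_mult[OF Ac M'(1) L'c]
    \<comment> \<open>The inverse of \<open>LM\<close> is \<open>M'L'\<close>: reassociating brings
      \<open>MM' = A\<close> into the middle, where it disappears.\<close>
    have "ideal_mult R (ideal_mult R L M) (ideal_mult R M' L')
        = ideal_mult R L (ideal_mult R M (ideal_mult R M' L'))"
      by (rule ideal_mult_assoc[OF Ac L M M'L'])
    also have "ideal_mult R M (ideal_mult R M' L') = ideal_mult R (ideal_mult R M M') L'"
      by (rule ideal_mult_assoc[OF Ac M M'(1) L'(1), symmetric])
    also have "\<dots> = L'" using ideal_mult_one[OF A L'(1)] M'(2) by simp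
    finally show ?thesis
      unfolding invertible_ideal_def using submod_ideal_mult[OF Ac L Mc] M'L' L'(2) by auto
  qed
  show ?thesis
  proof (rule comm_groupI)
    show "\<one>\<^bsub>inv_ideal_group R A\<^esub> \<in> carrier (inv_ideal_group R A)"
      using submod_subring[OF A] ideal_mult_one[OF A submod_subring[OF A]]
      unfolding inv_ideal_group_def invertible_ideal_def by auto
  next
    fix L assume "L \<in> carrier (inv_ideal_group R A)"
    then obtain L' where L: "submod R A L" and L': "submod R A L'" "ideal_mult R L L' = A"
      unfolding inv_ideal_group_def invertible_ideal_def by auto
    have "ideal_mult R L' L = A"
      using L'(2) ideal_mult_commute[OF submodD(1)[OF L] submodD(1)[OF L'(1)]] by simp
    with inv[OF L L'] show "\<exists>L'\<in>carrier (inv_ideal_group R A).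
        L' \<otimes>\<^bsub>inv_ideal_group R A\<^esub> L = \<one>\<^bsub>inv_ideal_group R A\<^esub>"
      unfolding inv_ideal_group_def by auto
  next
    fix L M N assume "L \<in> carrier (inv_ideal_group R A)" "M \<in> carrier (inv_ideal_group R A)"
      "N \<in> carrier (inv_ideal_group R A)"
    then show "L \<otimes>\<^bsub>inv_ideal_group R A\<^esub> M \<otimes>\<^bsub>inv_ideal_group R A\<^esub> N
        = L \<otimes>\<^bsub>inv_ideal_group R A\<^esub> (M \<otimes>\<^bsub>inv_ideal_group R A\<^esub> N)"
      using ideal_mult_assoc[OF Ac] by (simp add: inv_ideal_group_def invertible_ideal_def)
  next
    fix L M assume "L \<in> carrier (inv_ideal_group R A)" "M \<in> carrier (inv_ideal_group R A)"
    then show "L \<otimes>\<^bsub>inv_ideal_group R A\<^esub> M = M \<otimes>\<^bsub>inv_ideal_group R A\<^esub> L"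
      using ideal_mult_commute[OF submodD(1) submodD(1)]
      by (simp add: inv_ideal_group_def invertible_ideal_def) blast
  qed (use closed ideal_mult_one[OF A] in
      \<open>auto simp: inv_ideal_group_def invertible_ideal_def\<close>)
qed

section \<open>Principal ideals\<close>

lemma submod_principal:
  assumes A: "subring A R" and x: "x \<in> carrier R"
  shows "submod R A ((\<lambda>a. a \<otimes> x) ` A)"
proof -
  note Ac = subring_subset[OF A] and E = subringE[OF A]
  have "\<zero> \<in> (\<lambda>a. a \<otimes> x) ` A" using x E(2) by (intro image_eqI[of _ _ \<zero>]) auto
  moreover have "a \<otimes> x \<oplus> b \<otimes> x = (a \<oplus> b) \<otimes> x" if "a \<in> A" "b \<in> A" for a b
    using that Ac x by (simp add: l_distr subset_iff)
  moreover have "a \<otimes> (b \<otimes> x) = (a \<otimes> b) \<otimes> x" if "a \<in> A" "b \<in> A" for a b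
    using that Ac x by (simp add: m_assoc subset_iff)
  ultimately show ?thesis
    unfolding submod_def using E Ac x by (auto 0 3 simp: image_iff subset_iff)
qed

lemma principal_mult:
  assumes A: "subring A R" and x: "x \<in> carrier R" and y: "y \<in> carrier R"
  shows "ideal_mult R ((\<lambda>a. a \<otimes> x) ` A) ((\<lambda>a. a \<otimes> y) ` A) = (\<lambda>a. a \<otimes> (x \<otimes> y)) ` A"
proof
  note Ac = subring_subset[OF A] and E = subringE[OF A]
  note X = submodD(1)[OF submod_principal[OF A x]] and Y = submodD(1)[OF submod_principal[OF A y]]
  have xy: "x \<otimes> y \<in> carrier R" using x y by simp
  have eq: "(a \<otimes> x) \<otimes> (b \<otimes> y) = (a \<otimes> b) \<otimes> (x \<otimes> y)" if "a \<in> A" "b \<in> A" for a b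
    using that Ac x y by (simp add: subset_iff m_ac)
  show "ideal_mult R ((\<lambda>a. a \<otimes> x) ` A) ((\<lambda>a. a \<otimes> y) ` A) \<subseteq> (\<lambda>a. a \<otimes> (x \<otimes> y)) ` A"
    by (rule ideal_mult_subset[OF X Y submod_principal[OF A xy]]) (use eq E(6) in auto)
  show "(\<lambda>a. a \<otimes> (x \<otimes> y)) ` A \<subseteq> ideal_mult R ((\<lambda>a. a \<otimes> x) ` A) ((\<lambda>a. a \<otimes> y) ` A)"
  proof
    fix s assume "s \<in> (\<lambda>a. a \<otimes> (x \<otimes> y)) ` A"
    then obtain a where a: "a \<in> A" "s = a \<otimes> (x \<otimes> y)" by blast
    then have "s = (a \<otimes> x) \<otimes> (\<one> \<otimes> y)" using eq[OF a(1) E(3)] Ac by (auto simp: subset_iff)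
    then show "s \<in> ideal_mult R ((\<lambda>a. a \<otimes> x) ` A) ((\<lambda>a. a \<otimes> y) ` A)"
      using ideal_mult_mem[OF X Y] a(1) E(3) by blast
  qed
qed

lemma principal_invertible:
  assumes A: "subring A R" and x: "x \<in> Units R"
  shows "invertible_ideal R A ((\<lambda>a. a \<otimes> x) ` A)"
    "ideal_mult R ((\<lambda>a. a \<otimes> x) ` A) ((\<lambda>a. a \<otimes> inv x) ` A) = A"
proof -
  have "(\<lambda>a. a \<otimes> \<one>) ` A = A" using subring_subset[OF A] by force
  then show "ideal_mult R ((\<lambda>a. a \<otimes> x) ` A) ((\<lambda>a. a \<otimes> inv x) ` A) = A"
    using principal_mult[OF A, of x "inv x"] x Units_r_inv[OF x] by (simp add: Units_closed)
  then show "invertible_ideal R A ((\<lambda>a. a \<otimes> x) ` A)"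
    unfolding invertible_ideal_def using submod_principal[OF A] x by blast
qed

text \<open>Every subgroup of an abelian group is normal. The subgroup laws hold because passing
  from a unit to the ideal it generates respects products, so the inverse unit generates the inverse
  ideal.\<close>

lemma principal_normal:
  assumes A: "subring A R"
  shows "principal_ideals R A \<lhd> inv_ideal_group R A"
proof -
  let ?G = "inv_ideal_group R A"
  interpret G: comm_group ?G by (rule inv_ideal_comm_group[OF A])
  have "subgroup (principal_ideals R A) ?G"
  proof (rule G.subgroupI)
    show "principal_ideals R A \<subseteq> carrier ?G"
      using principal_invertible(1)[OF A] by (auto simp: principal_ideals_def inv_ideal_group_def)
    show "principal_ideals R A \<noteq> {}" unfolding principal_ideals_def by blast
  next
    fix L assume "L \<in> principal_ideals R A"
    then obtain x where x: "x \<in> Units R" "L = (\<lambda>a. a \<otimes> x) ` A"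
      unfolding principal_ideals_def by blast
    have x': "inv x \<in> Units R" using x by simp
    have "inv\<^bsub>?G\<^esub> L = (\<lambda>a. a \<otimes> inv x) ` A"
      using principal_invertible[OF A x(1)] principal_invertible(1)[OF A x'] x(2)
        ideal_mult_commute[OF submodD(1) submodD(1), of A _ A]
      by (intro G.comm_inv_char) (auto simp: inv_ideal_group_def)
    then show "inv\<^bsub>?G\<^esub> L \<in> principal_ideals R A" using x' unfolding principal_ideals_def by blast
  next
    fix L M assume "L \<in> principal_ideals R A" "M \<in> principal_ideals R A"
    then obtain x y where "x \<in> Units R" "L = (\<lambda>a. a \<otimes> x) ` A" "y \<in> Units R" "M = (\<lambda>a. a \<otimes> y) ` A"
      unfolding principal_ideals_def by blast
    then have "L \<otimes>\<^bsub>?G\<^esub> M = (\<lambda>a. a \<otimes> (x \<otimes> y)) ` A" "x \<otimes> y \<in> Units R"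
      using principal_mult[OF A, of x y] by (auto simp: inv_ideal_group_def)
    then show "L \<otimes>\<^bsub>?G\<^esub> M \<in> principal_ideals R A" unfolding principal_ideals_def by blast
  qed
  then show ?thesis by (rule G.subgroup_imp_normal)
qed

end

section \<open>Nilpotent elements and lifting of idempotents\<close>

context cring
begin

text \<open>The binomial theorem is avoided by induction on \<open>s\<close> for the stronger claim
  that \<open>x^a y^b (x+y)^s\<close> vanishes whenever \<open>m + n \<le> a + b + s\<close>.
  Peeling off one factor \<open>x+y\<close> raises \<open>a\<close> or \<open>b\<close> by one, and
  at \<open>s = 0\<close> one of these exponents is already large enough.\<close>

lemma nilpotent_add:
  fixes m n :: nat
  assumes x: "x \<in> carrier R" "x [^] m = \<zero>" and y: "y \<in> carrier R" "y [^] n = \<zero>"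
  shows "(x \<oplus> y) [^] (m + n) = \<zero>"
proof -
  have ge: "z [^] l = \<zero>" if "z \<in> carrier R" "z [^] k = \<zero>" "k \<le> l" for z and k l :: nat
    using that nat_pow_mult[of z k "l - k"] by simp
  have "x [^] a \<otimes> y [^] b \<otimes> (x \<oplus> y) [^] s = \<zero>" if "m + n \<le> a + b + s" for a b s :: nat
    using that
  proof (induction s arbitrary: a b)
    case 0
    then have "m \<le> a \<or> n \<le> b" by arith
    then show ?case using ge[OF x] ge[OF y] x(1) y(1) by auto
  next
    case (Suc s)
    have "x [^] a \<otimes> y [^] b \<otimes> (x \<oplus> y) [^] Suc s
        = x [^] Suc a \<otimes> y [^] b \<otimes> (x \<oplus> y) [^] s \<oplus> x [^] a \<otimes> y [^] Suc b \<otimes> (x \<oplus> y) [^] s"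
    proof -
      have "u \<otimes> v \<otimes> (w \<otimes> (x \<oplus> y)) = (u \<otimes> x) \<otimes> v \<otimes> w \<oplus> u \<otimes> (v \<otimes> y) \<otimes> w"
        if "u \<in> carrier R" "v \<in> carrier R" "w \<in> carrier R" for u v w
        using that x(1) y(1) by algebra
      then show ?thesis using x(1) y(1) by simp
    qed
    then show ?case using Suc.IH[of "Suc a" b] Suc.IH[of a "Suc b"] Suc.prems by simp
  qed
  from this[of 0 0 "m + n"] show ?thesis using x(1) y(1) by simp
qed

lemma nilradical_ideal: "ideal (nilradical R) R"
proof (rule idealI)
  have mul: "x \<otimes> a \<in> nilradical R" if a: "a \<in> nilradical R" and x: "x \<in> carrier R" for a x
  proof -
    obtain n :: nat where n: "a \<in> carrier R" "a [^] n = \<zero>" using a by (auto simp: nilradical_def)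
    have "(x \<otimes> a) [^] n = \<zero>" using n x by (simp add: nat_pow_distrib)
    then show ?thesis using n x unfolding nilradical_def by auto
  qed
  then show "x \<otimes> a \<in> nilradical R" if "a \<in> nilradical R" "x \<in> carrier R" for a x
    using that by blast
  show "a \<otimes> x \<in> nilradical R" if "a \<in> nilradical R" "x \<in> carrier R" for a x
    using mul[OF that] that m_comm[of a x] by (auto simp: nilradical_def)
  show "subgroup (nilradical R) (add_monoid R)"
  proof (rule add.subgroupI)
    show "nilradical R \<subseteq> carrier R" by (auto simp: nilradical_def)
    have "\<zero> [^] (1::nat) = \<zero>" by simp
    then show "nilradical R \<noteq> {}" unfolding nilradical_def by blast
    fix a assume a: "a \<in> nilradical R"
    then have "\<ominus> a = (\<ominus> \<one>) \<otimes> a" by (simp add: l_minus nilradical_def)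
    then show "\<ominus> a \<in> nilradical R" using mul[OF a, of "\<ominus> \<one>"] by simp
    fix b assume "b \<in> nilradical R"
    with a show "a \<oplus> b \<in> nilradical R"
      using nilpotent_add unfolding nilradical_def by blast
  qed
qed (rule ring_axioms)

text \<open>Truncated geometric series, generated by replacing \<open>w\<close> with
  \<open>1 + zw\<close>. The partial sums stay in \<open>A\<close>, so the inverse lies in the
  subring and not merely in the ambient ring.\<close>

lemma unipotent_inverse:
  fixes k :: nat
  assumes A: "subring A R" and z: "z \<in> A" "z [^] k = \<zero>"
  shows "\<exists>w\<in>A. (\<one> \<ominus> z) \<otimes> w = \<one>"
proof -
  note Ac = subring_subset[OF A] and E = subringE[OF A]
  have zc: "z \<in> carrier R" using z Ac by blast
  have "\<exists>w\<in>A. (\<one> \<ominus> z) \<otimes> w = \<one> \<ominus> z [^] j" for j :: nat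
  proof (induction j)
    case 0
    show ?case by (rule bexI[of _ \<zero>]) (use zc E in \<open>auto simp: r_neg minus_eq\<close>)
  next
    case (Suc j)
    then obtain w where w: "w \<in> A" "(\<one> \<ominus> z) \<otimes> w = \<one> \<ominus> z [^] j" by blast
    have "(\<one> \<ominus> z) \<otimes> (\<one> \<oplus> z \<otimes> w) = (\<one> \<ominus> z) \<oplus> z \<otimes> ((\<one> \<ominus> z) \<otimes> w)"
      using zc w(1) Ac by (simp add: r_distr m_lcomm subset_iff)
    also have "\<dots> = (\<one> \<ominus> z) \<oplus> z \<otimes> (\<one> \<ominus> z [^] j)" using w(2) by simp
    also have "\<dots> = \<one> \<ominus> z [^] Suc j"
    proof -
      have "(\<one> \<ominus> z) \<oplus> z \<otimes> (\<one> \<ominus> v) = \<one> \<ominus> v \<otimes> z" if "v \<in> carrier R" for v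
        using zc that by algebra
      then show ?thesis using zc by simp
    qed
    finally have "(\<one> \<ominus> z) \<otimes> (\<one> \<oplus> z \<otimes> w) = \<one> \<ominus> z [^] Suc j" .
    moreover have "\<one> \<oplus> z \<otimes> w \<in> A" using E z w by auto
    ultimately show ?case by blast
  qed
  from this[of k] show ?thesis using z(2) by (simp add: minus_eq)
qed

section \<open>Comaximal powers and lifting of idempotents\<close>

lemma comaximal_powers:
  fixes k l :: nat
  assumes a: "a \<in> carrier R" and b: "b \<in> carrier R" and ab: "a \<oplus> b = \<one>"
  shows "\<exists>p\<in>carrier R. \<exists>q\<in>carrier R. a [^] k \<otimes> p \<oplus> b [^] l \<otimes> q = \<one>"
proof -
  \<comment> \<open>Multiplying the two relations raises the exponent of \<open>x\<close> by one;
    all other terms of the product are divisible by \<open>y\<close>.\<close>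
  have step: "\<exists>p'\<in>carrier R. \<exists>q'\<in>carrier R. x [^] Suc i \<otimes> p' \<oplus> y \<otimes> q' = \<one>"
    if c: "x \<in> carrier R" "y \<in> carrier R" "p \<in> carrier R" "q \<in> carrier R" "p0 \<in> carrier R" "q0 \<in> carrier R"
      and e: "x [^] i \<otimes> p \<oplus> y \<otimes> q = \<one>" "x \<otimes> p0 \<oplus> y \<otimes> q0 = \<one>" for x y p q p0 q0 and i :: nat
  proof (intro bexI)
    define r where "r = x [^] i"
    have r: "r \<in> carrier R" unfolding r_def using c by simp
    have "\<one> = (r \<otimes> p \<oplus> y \<otimes> q) \<otimes> (x \<otimes> p0 \<oplus> y \<otimes> q0)"
      using e unfolding r_def by simp
    also have "\<dots> = (r \<otimes> x) \<otimes> (p \<otimes> p0) \<oplus> y \<otimes> (q \<otimes> (x \<otimes> p0 \<oplus> y \<otimes> q0) \<oplus> r \<otimes> p \<otimes> q0)"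
      using c r by algebra
    finally show "x [^] Suc i \<otimes> (p \<otimes> p0) \<oplus> y \<otimes> (q \<otimes> (x \<otimes> p0 \<oplus> y \<otimes> q0) \<oplus> r \<otimes> p \<otimes> q0) = \<one>"
      unfolding r_def by simp
    show "p \<otimes> p0 \<in> carrier R" "q \<otimes> (x \<otimes> p0 \<oplus> y \<otimes> q0) \<oplus> r \<otimes> p \<otimes> q0 \<in> carrier R"
      using c r by auto
  qed
  have one: "\<exists>p\<in>carrier R. \<exists>q\<in>carrier R. x [^] i \<otimes> p \<oplus> y \<otimes> q = \<one>"
    if c: "x \<in> carrier R" "y \<in> carrier R" "p0 \<in> carrier R" "q0 \<in> carrier R"
      and e: "x \<otimes> p0 \<oplus> y \<otimes> q0 = \<one>" for x y p0 q0 and i :: nat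
  proof (induction i)
    case 0
    show ?case using c by (intro bexI[of _ \<one>] bexI[of _ \<zero>]) auto
  next
    case (Suc i)
    then show ?case using step[OF c(1,2) _ _ c(3,4) _ e] by blast
  qed
  obtain p q where pq: "p \<in> carrier R" "q \<in> carrier R" "a [^] k \<otimes> p \<oplus> b \<otimes> q = \<one>"
    using one[of a b \<one> \<one> k] a b ab by auto
  \<comment> \<open>The roles are exchanged: \<open>a [^] k\<close> is now the fixed element while
    the power of \<open>b\<close> grows.\<close>
  then have "b \<otimes> q \<oplus> a [^] k \<otimes> p = \<one>" using a b by (simp add: a_comm)
  from one[OF b _ pq(2,1) this, of l] obtain q' p' where
    "q' \<in> carrier R" "p' \<in> carrier R" "b [^] l \<otimes> q' \<oplus> a [^] k \<otimes> p' = \<one>" using a by auto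
  then show ?thesis using a b by (metis a_comm m_closed nat_pow_closed)
qed

text \<open>Comaximality of powers splits 1 into \<open>e + f\<close> with \<open>e\<close> a
  multiple of \<open>a^(m+1)\<close> and \<open>f\<close> a multiple of \<open>b^(m+1)\<close>. Then
  \<open>ef\<close> is a multiple of \<open>(ab)^m = 0\<close>, which makes \<open>e\<close>
  idempotent. The exponent is \<open>m+1\<close> rather than \<open>m\<close> because the spare
  factors \<open>a\<close> in \<open>e\<close> and \<open>b\<close> in \<open>f\<close> make
  \<open>e - a\<close> a multiple of \<open>ab\<close>; the witness \<open>w\<close> records that
  \<open>e\<close> agrees with \<open>a\<close> modulo \<open>ab\<close>.\<close>

lemma lift_idempotent_cring:
  fixes m :: nat
  assumes a: "a \<in> carrier R" and b: "b \<in> carrier R" and ab: "a \<oplus> b = \<one>"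
    and nil: "(a \<otimes> b) [^] m = \<zero>"
  shows "\<exists>e\<in>carrier R. \<exists>w\<in>carrier R. e \<otimes> e = e \<and> e = a \<oplus> (a \<otimes> b) \<otimes> w"
proof -
  obtain p q where pq: "p \<in> carrier R" "q \<in> carrier R" "a [^] Suc m \<otimes> p \<oplus> b [^] Suc m \<otimes> q = \<one>"
    using comaximal_powers[OF a b ab, of "Suc m" "Suc m"] by blast
  define u v where "u = a [^] m" and "v = b [^] m"
  have c: "u \<in> carrier R" "v \<in> carrier R" unfolding u_def v_def using a b by auto
  have uv: "u \<otimes> v = \<zero>" unfolding u_def v_def using nil a b by (simp add: nat_pow_distrib)
  have one: "u \<otimes> a \<otimes> p \<oplus> v \<otimes> b \<otimes> q = \<one>" using pq(3) unfolding u_def v_def by simp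
  define e where "e = u \<otimes> a \<otimes> p"
  define f where "f = v \<otimes> b \<otimes> q"
  have ef: "e \<in> carrier R" "f \<in> carrier R" "e \<oplus> f = \<one>"
    unfolding e_def f_def using c a b pq one by auto
  have "e \<otimes> f = (u \<otimes> v) \<otimes> (a \<otimes> p \<otimes> b \<otimes> q)"
    unfolding e_def f_def using c a b pq by algebra
  then have "e \<otimes> f = \<zero>" using uv a b pq by simp
  moreover have "e = e \<otimes> e \<oplus> e \<otimes> f" using ef r_distr[of e f e] by simp
  ultimately have idem: "e \<otimes> e = e" using ef by simp
  \<comment> \<open>The added zero lets \<open>e - a\<close> become
    \<open>e(a+b) - a(e+f) = eb - af\<close> by a pure ring identity; \<open>a + b = 1\<close> and
    \<open>e + f = 1\<close> are applied only before and after it.\<close>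
  have "e = e \<otimes> (a \<oplus> b) \<oplus> (a \<otimes> (e \<oplus> f) \<ominus> a \<otimes> (e \<oplus> f))"
    using ef a ab by (simp add: minus_eq r_neg)
  also have "\<dots> = a \<otimes> (e \<oplus> f) \<oplus> (e \<otimes> b \<ominus> a \<otimes> f)"
    using ef(1,2) a b by algebra
  also have "\<dots> = a \<oplus> (e \<otimes> b \<ominus> a \<otimes> f)" using ef a by simp
  also have "e \<otimes> b \<ominus> a \<otimes> f = (a \<otimes> b) \<otimes> (u \<otimes> p \<ominus> v \<otimes> q)"
    unfolding e_def f_def using c a b pq(1,2) by algebra
  finally have "e = a \<oplus> (a \<otimes> b) \<otimes> (u \<otimes> p \<ominus> v \<otimes> q)" .
  then show ?thesis using idem ef(1) c pq by blast
qed

end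

text \<open>The commutative case applies inside the bicommutant of \<open>a\<close>.\<close>

lemma (in ring) lift_idempotent:
  fixes m :: nat
  assumes T: "subring T R" and a: "a \<in> T" and b: "b \<in> T" and ab: "a \<oplus> b = \<one>"
    and nil: "(a \<otimes> b) [^] m = \<zero>"
  shows "\<exists>e\<in>T. \<exists>w\<in>T. e \<otimes> e = e \<and> e = a \<oplus> (a \<otimes> b) \<otimes> w"
proof -
  have Tc: "T \<subseteq> carrier R" by (rule subringE(1)[OF T])
  note E = subringE[OF T]
  \<comment> \<open>\<open>C\<close> is the commutant of \<open>a\<close>, and \<open>K\<close> is
    the part of \<open>T\<close> that commutes with all of \<open>C\<close>. Since \<open>a\<close>
    lies in \<open>C\<close>, elements of \<open>K\<close> commute with \<open>a\<close>, so
    \<open>K\<close> is contained in \<open>C\<close> and is therefore commutative.\<close>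
  define C where "C = {y \<in> carrier R. y \<otimes> a = a \<otimes> y}"
  define K where "K = {x \<in> T. \<forall>y\<in>C. x \<otimes> y = y \<otimes> x}"
  have ac: "a \<in> carrier R" "b \<in> carrier R" using a b Tc by auto
  have aC: "a \<in> C" unfolding C_def using ac by simp
  have aK: "a \<in> K" unfolding K_def C_def using a by auto
  have KC: "K \<subseteq> C" unfolding K_def using aC by (auto simp: C_def Tc[THEN subsetD])
  have "subring K R"
  proof (rule subringI)
    show "K \<subseteq> carrier R" using Tc unfolding K_def by blast
    show "\<one> \<in> K" unfolding K_def C_def using E by simp
    fix h assume h: "h \<in> K"
    then have "h \<in> carrier R" using Tc unfolding K_def by blast
    with h show "\<ominus> h \<in> K" unfolding K_def C_def using E(5) by (auto simp: l_minus r_minus)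
    fix k assume k: "k \<in> K"
    then have kc: "k \<in> carrier R" using Tc unfolding K_def by blast
    note hc = \<open>h \<in> carrier R\<close>
    have "h \<otimes> k \<otimes> y = y \<otimes> (h \<otimes> k)" if "y \<in> C" for y
    proof -
      have "y \<in> carrier R" "k \<otimes> y = y \<otimes> k" "h \<otimes> y = y \<otimes> h"
        using h k that unfolding K_def C_def by auto
      then show ?thesis using hc kc by (metis m_assoc)
    qed
    then show "h \<otimes> k \<in> K" using h k E(6) unfolding K_def by blast
    show "h \<oplus> k \<in> K" using h k hc kc E(7) unfolding K_def C_def by (auto simp: l_distr r_distr)
  qed
  moreover have "h \<otimes> k = k \<otimes> h" if "h \<in> K" "k \<in> K" for h k
    using that KC unfolding K_def by blast
  ultimately have "subcring K R" by (rule subcringI)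
  then have K: "cring (R\<lparr>carrier := K\<rparr>)" using subcring_iff[of K] \<open>subring K R\<close> subringE(1) by blast
  have "b = \<one> \<ominus> a" using ab ac by (metis add.inv_solve_right' minus_eq one_closed a_comm)
  then have bK: "b \<in> K" using subringE[OF \<open>subring K R\<close>] aK by (simp add: minus_eq)
  have "(a \<otimes> b) [^]\<^bsub>R\<lparr>carrier := K\<rparr>\<^esub> m = \<zero>"
    using nil nat_pow_consistent[of "a \<otimes> b" m K] by simp
  then have "\<exists>e\<in>K. \<exists>w\<in>K. e \<otimes> e = e \<and> e = a \<oplus> (a \<otimes> b) \<otimes> w"
    using cring.lift_idempotent_cring[OF K, of a b m] aK bK ab by simp
  then show ?thesis unfolding K_def by blast
qed

section \<open>Powers of ideals and nilpotent ideals\<close>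

primrec ideal_pow :: "('a, 'b) ring_scheme \<Rightarrow> 'a set \<Rightarrow> nat \<Rightarrow> 'a set" where
  "ideal_pow R K 0 = carrier R"
| "ideal_pow R K (Suc k) = ideal_mult R K (ideal_pow R K k)"

context cring
begin

lemma submod_ideal_pow:
  assumes "submod R (carrier R) K"
  shows "submod R (carrier R) (ideal_pow R K k)"
proof (induction k)
  case 0
  then show ?case using submod_subring[OF carrier_is_subring] by simp
next
  case (Suc k)
  then show ?case using submod_ideal_mult[OF subset_refl assms submodD(1)[OF Suc]] by simp
qed

lemma ideal_pow_add:
  assumes K: "submod R (carrier R) K"
  shows "ideal_pow R K (k + l) = ideal_mult R (ideal_pow R K k) (ideal_pow R K l)"
proof (induction k)
  case 0
  then show ?case using ideal_mult_one(2)[OF carrier_is_subring submod_ideal_pow[OF K]] by simp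
next
  case (Suc k)
  then show ?case
    using ideal_mult_assoc[OF subset_refl K submod_ideal_pow[OF K] submod_ideal_pow[OF K]] by simp
qed

text \<open>The new ideal is \<open>K' = K + zR\<close>. Modulo \<open>zR\<close> its powers are
  those of \<open>K\<close>, so \<open>K'^m\<close> lies in \<open>zR\<close> because
  \<open>K^m = 0\<close>. Hence \<open>K'^(mt)\<close> lies in \<open>z^t R\<close>, which vanishes
  at \<open>t = q\<close>.\<close>

lemma adjoin_nilpotent:
  fixes q :: nat
  assumes K: "submod R (carrier R) K" and m: "ideal_pow R K m = {\<zero>}"
    and z: "z \<in> carrier R" "z [^] q = \<zero>"
  shows "\<exists>K' m'. submod R (carrier R) K' \<and> insert z K \<subseteq> K' \<and> ideal_pow R K' m' = {\<zero>}"
proof -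
  define adj where "adj I = {s \<oplus> z \<otimes> r | s r. s \<in> I \<and> r \<in> carrier R}" for I
  have sub_adj: "submod R (carrier R) (adj I)" if I: "submod R (carrier R) I" for I
  proof -
    note D = submodD[OF I]
    have "\<exists>s' r'. (s \<oplus> z \<otimes> r) \<oplus> (t \<oplus> z \<otimes> r2) = s' \<oplus> z \<otimes> r' \<and> s' \<in> I \<and> r' \<in> carrier R"
      if "s \<in> I" "t \<in> I" "r \<in> carrier R" "r2 \<in> carrier R" for s t r r2
    proof -
      have "s \<in> carrier R" "t \<in> carrier R" using that D by auto
      then have "(s \<oplus> z \<otimes> r) \<oplus> (t \<oplus> z \<otimes> r2) = (s \<oplus> t) \<oplus> z \<otimes> (r \<oplus> r2)"
        using that z(1) by algebra
      then show ?thesis using D(3) that by blast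
    qed
    moreover have "\<exists>s' r'. a \<otimes> (s \<oplus> z \<otimes> r) = s' \<oplus> z \<otimes> r' \<and> s' \<in> I \<and> r' \<in> carrier R"
      if "s \<in> I" "a \<in> carrier R" "r \<in> carrier R" for s a r
    proof -
      have "s \<in> carrier R" using that D by auto
      then have "a \<otimes> (s \<oplus> z \<otimes> r) = (a \<otimes> s) \<oplus> z \<otimes> (a \<otimes> r)"
        using that z(1) by algebra
      then show ?thesis using D(4) that by blast
    qed
    moreover have "\<exists>s r. \<zero> = s \<oplus> z \<otimes> r \<and> s \<in> I \<and> r \<in> carrier R"
      using D(2) z(1) by (intro exI[of _ \<zero>]) simp
    moreover have "adj I \<subseteq> carrier R" unfolding adj_def using D(1) z(1) by auto
    ultimately show ?thesis unfolding submod_def by (auto simp: adj_def)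
  qed
  let ?K = "adj K"
  note K' = sub_adj[OF K] and K'p = submod_ideal_pow[OF sub_adj[OF K]]
  have adjI: "ideal_pow R ?K j \<subseteq> adj (ideal_pow R K j)" for j
  proof (induction j)
    case 0
    have "x \<in> adj (carrier R)" if "x \<in> carrier R" for x
      unfolding adj_def using that z(1) by (intro CollectI exI[of _ x] exI[of _ \<zero>]) simp
    then show ?case by auto
  next
    case (Suc j)
    note P = submod_ideal_pow[OF K, of j] and PS = submod_ideal_pow[OF K, of "Suc j"]
    have "x \<otimes> y \<in> adj (ideal_pow R K (Suc j))" if xy: "x \<in> ?K" "y \<in> ideal_pow R ?K j" for x y
    proof -
      obtain k r where x: "x = k \<oplus> z \<otimes> r" "k \<in> K" "r \<in> carrier R" using xy(1) unfolding adj_def by blast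
      obtain s t where y: "y = s \<oplus> z \<otimes> t" "s \<in> ideal_pow R K j" "t \<in> carrier R"
        using xy(2) Suc unfolding adj_def by blast
      have c: "k \<in> carrier R" "s \<in> carrier R"
        using x y submodD(1)[OF K] submodD(1)[OF P] by auto
      have "x \<otimes> y = k \<otimes> s \<oplus> z \<otimes> (r \<otimes> s \<oplus> k \<otimes> t \<oplus> r \<otimes> z \<otimes> t)"
        unfolding x(1) y(1) using c x(3) y(3) z(1) by algebra
      moreover have "k \<otimes> s \<in> ideal_pow R K (Suc j)"
        using ideal_mult_mem[OF submodD(1)[OF K] submodD(1)[OF P] x(2) y(2)] by simp
      ultimately show ?thesis unfolding adj_def using c x(3) y(3) z(1) by blast
    qed
    then show ?case
      using ideal_mult_subset[OF submodD(1)[OF K'] submodD(1)[OF K'p] sub_adj[OF PS]] by simp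
  qed
  have zR: "ideal_pow R ?K (m * t) \<subseteq> {z [^] t \<otimes> r | r. r \<in> carrier R}" for t
  proof (induction t)
    case 0
    then show ?case by (auto intro!: exI)
  next
    case (Suc t)
    let ?Z = "{z [^] Suc t \<otimes> r | r. r \<in> carrier R}"
    have Z: "submod R (carrier R) ?Z"
    proof -
      define y where "y = z [^] Suc t"
      have y: "y \<in> carrier R" unfolding y_def using z by simp
      have "{y \<otimes> r | r. r \<in> carrier R} = (\<lambda>r. r \<otimes> y) ` carrier R"
        using m_comm[OF y] by (simp add: Setcompr_eq_image)
      then show ?thesis using submod_principal[OF carrier_is_subring y] unfolding y_def by simp
    qed
    have "x \<otimes> y \<in> ?Z" if x: "x \<in> ideal_pow R ?K m" and y: "y \<in> ideal_pow R ?K (m * t)" for x y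
    proof -
      obtain r where r: "x = z \<otimes> r" "r \<in> carrier R"
        using x adjI[of m] z(1) unfolding m by (auto simp: adj_def)
      obtain s where s: "y = z [^] t \<otimes> s" "s \<in> carrier R" using y Suc by blast
      have "x \<otimes> y = z [^] Suc t \<otimes> (r \<otimes> s)" unfolding r(1) s(1) using r(2) s(2) z(1) by (simp add: m_ac)
      then show ?thesis using r(2) s(2) by blast
    qed
    then show ?case
      using ideal_mult_subset[OF submodD(1)[OF K'p] submodD(1)[OF K'p] Z, of m "m * t"]
        ideal_pow_add[OF K', of m "m * t"] by simp
  qed
  have "ideal_pow R ?K (m * q) \<subseteq> {\<zero>}" using zR[of q] z by auto
  then have "ideal_pow R ?K (m * q) = {\<zero>}" using submodD(2)[OF K'p] by blast
  moreover have "z = \<zero> \<oplus> z \<otimes> \<one>" using z by simp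
  then have "z \<in> ?K" unfolding adj_def using submodD(2)[OF K] by blast
  moreover have "k \<in> ?K" if "k \<in> K" for k
    unfolding adj_def using that z(1) submodD(1)[OF K] by (intro CollectI exI[of _ k] exI[of _ \<zero>]) auto
  ultimately show ?thesis using K' by blast
qed

text \<open>The nilradical itself may fail to be nilpotent, but finitely many of its elements lie in
  a nilpotent ideal. Powers of a matrix with nilpotent entries are controlled through such a common
  ideal.\<close>

lemma finite_nilpotents_in_nilpotent_ideal:
  assumes "finite T" "T \<subseteq> nilradical R"
  shows "\<exists>K m. submod R (carrier R) K \<and> T \<subseteq> K \<and> ideal_pow R K m = {\<zero>}"
  using assms
proof (induction T rule: finite_induct)
  case empty
  have 0: "submod R (carrier R) {\<zero>}" unfolding submod_def by auto
  have "ideal_mult R {\<zero>} (carrier R) = {\<zero>}"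
    using ideal_mult_one(1)[OF carrier_is_subring 0] .
  then have "ideal_pow R {\<zero>} 1 = {\<zero>}" by simp
  then show ?case using 0 by blast
next
  case (insert z T)
  then obtain K m where K: "submod R (carrier R) K" "T \<subseteq> K" "ideal_pow R K m = {\<zero>}" by auto
  obtain q :: nat where "z \<in> carrier R" "z [^] q = \<zero>" using insert.prems by (auto simp: nilradical_def)
  from adjoin_nilpotent[OF K(1,3) this] show ?case using K(2) by blast
qed

end

section \<open>Matrices over a commutative ring\<close>

text \<open>Only the summation index is bounded by \<open>n\<close>, while \<open>i\<close> and
  \<open>j\<close> are free. The same product therefore also handles rows, written as matrices
  constant in the first index, and columns, constant in the second.\<close>

definition mat_mult :: "('a, 'b) ring_scheme \<Rightarrow> nat \<Rightarrow> (nat \<Rightarrow> nat \<Rightarrow> 'a) \<Rightarrow> (nat \<Rightarrow> nat \<Rightarrow> 'a) \<Rightarrow> nat \<Rightarrow> nat \<Rightarrow> 'a" where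
  "mat_mult R n M N i j = finsum R (\<lambda>k. M i k \<otimes>\<^bsub>R\<^esub> N k j) {..<n}"

text \<open>An \<open>n \<times> n\<close> matrix is indexed by all of \<open>nat \<times> nat\<close> and vanishes outside the square, so
  that the ring operations need no range conditions.\<close>

definition mat_ring :: "('a, 'b) ring_scheme \<Rightarrow> nat \<Rightarrow> (nat \<Rightarrow> nat \<Rightarrow> 'a) ring" where
  "mat_ring R n = \<lparr>
     carrier = {M. \<forall>i j. M i j \<in> carrier R \<and> (n \<le> i \<or> n \<le> j \<longrightarrow> M i j = \<zero>\<^bsub>R\<^esub>)},
     monoid.mult = mat_mult R n,
     monoid.one = (\<lambda>i j. if i = j \<and> i < n then \<one>\<^bsub>R\<^esub> else \<zero>\<^bsub>R\<^esub>),
     ring.zero = (\<lambda>i j. \<zero>\<^bsub>R\<^esub>),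
     ring.add = (\<lambda>M N i j. M i j \<oplus>\<^bsub>R\<^esub> N i j)\<rparr>"

context cring
begin

lemma finsum_swap:
  assumes "finite I" "finite J" "\<And>i j. \<lbrakk>i \<in> I; j \<in> J\<rbrakk> \<Longrightarrow> f i j \<in> carrier R"
  shows "finsum R (\<lambda>i. finsum R (f i) J) I = finsum R (\<lambda>j. finsum R (\<lambda>i. f i j) I) J"
  using assms(1,3)
proof (induction I rule: finite_induct)
  case empty
  then show ?case by simp
next
  case (insert i I)
  have "finsum R (\<lambda>i. finsum R (f i) J) (insert i I) = finsum R (f i) J \<oplus> finsum R (\<lambda>i. finsum R (f i) J) I"
    using insert by (intro finsum_insert) (auto intro!: finsum_closed)
  also have "finsum R (\<lambda>i. finsum R (f i) J) I = finsum R (\<lambda>j. finsum R (\<lambda>i. f i j) I) J"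
    using insert by auto
  also have "finsum R (f i) J \<oplus> finsum R (\<lambda>j. finsum R (\<lambda>i. f i j) I) J
      = finsum R (\<lambda>j. f i j \<oplus> finsum R (\<lambda>i. f i j) I) J"
    using insert by (intro finsum_addf[symmetric]) (auto intro!: finsum_closed)
  also have "\<dots> = finsum R (\<lambda>j. finsum R (\<lambda>i. f i j) (insert i I)) J"
    using insert by (intro finsum_cong') (auto intro!: finsum_closed finsum_insert[symmetric])
  finally show ?case .
qed

lemma mat_mult_closed [intro, simp]:
  assumes "\<And>i j. M i j \<in> carrier R" "\<And>i j. N i j \<in> carrier R"
  shows "mat_mult R n M N i j \<in> carrier R"
  unfolding mat_mult_def using assms by (intro finsum_closed) auto

text \<open>Interchange of the two sums. The entries are only asked to lie in the ring, without
  vanishing outside a square, so the law also covers products with rows and columns.\<close>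

lemma mat_mult_assoc:
  assumes "\<And>i j. M i j \<in> carrier R" "\<And>i j. N i j \<in> carrier R" "\<And>i j. P i j \<in> carrier R"
  shows "mat_mult R m (mat_mult R n M N) P = mat_mult R n M (mat_mult R m N P)"
proof (intro ext)
  fix i j
  have "mat_mult R m (mat_mult R n M N) P i j
      = finsum R (\<lambda>k. finsum R (\<lambda>l. M i l \<otimes> N l k \<otimes> P k j) {..<n}) {..<m}"
    unfolding mat_mult_def
    by (intro finsum_cong' finsum_ldistr) (auto intro!: finsum_closed simp: assms)
  also have "\<dots> = finsum R (\<lambda>l. finsum R (\<lambda>k. M i l \<otimes> N l k \<otimes> P k j) {..<m}) {..<n}"
    by (rule finsum_swap) (auto simp: assms)
  also have "\<dots> = finsum R (\<lambda>l. finsum R (\<lambda>k. M i l \<otimes> (N l k \<otimes> P k j)) {..<m}) {..<n}"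
    by (intro finsum_cong') (auto intro!: finsum_closed finsum_cong' simp: assms m_assoc)
  also have "\<dots> = mat_mult R n M (mat_mult R m N P) i j"
    unfolding mat_mult_def
    by (intro finsum_cong' finsum_rdistr[symmetric]) (auto intro!: finsum_closed simp: assms)
  finally show "mat_mult R m (mat_mult R n M N) P i j = mat_mult R n M (mat_mult R m N P) i j" .
qed

lemma mat_ring_simps:
  "M \<in> carrier (mat_ring R n) \<longleftrightarrow> (\<forall>i j. M i j \<in> carrier R \<and> (n \<le> i \<or> n \<le> j \<longrightarrow> M i j = \<zero>))"
  "M \<otimes>\<^bsub>mat_ring R n\<^esub> N = mat_mult R n M N"
  "\<one>\<^bsub>mat_ring R n\<^esub> = (\<lambda>i j. if i = j \<and> i < n then \<one> else \<zero>)"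
  "\<zero>\<^bsub>mat_ring R n\<^esub> = (\<lambda>i j. \<zero>)"
  "M \<oplus>\<^bsub>mat_ring R n\<^esub> N = (\<lambda>i j. M i j \<oplus> N i j)"
  by (simp_all add: mat_ring_def)

lemma finsum_delta:
  assumes "i < n" "\<And>j. f j \<in> carrier R"
  shows "finsum R (\<lambda>j. if i = j then f j else \<zero>) {..<n::nat} = f i"
  by (rule finsum_singleton) (use assms in auto)

lemma ring_mat_ring: "ring (mat_ring R n)"
proof (rule ringI)
  show "abelian_group (mat_ring R n)"
  proof (rule abelian_groupI)
    fix M assume M: "M \<in> carrier (mat_ring R n)"
    show "\<exists>N\<in>carrier (mat_ring R n). N \<oplus>\<^bsub>mat_ring R n\<^esub> M = \<zero>\<^bsub>mat_ring R n\<^esub>"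
      using M by (intro bexI[of _ "\<lambda>i j. \<ominus> M i j"]) (auto simp: mat_ring_simps l_neg)
  qed (auto simp: mat_ring_simps a_ac)
  show "monoid (mat_ring R n)"
  proof (rule monoidI)
    fix M N assume M: "M \<in> carrier (mat_ring R n)" and N: "N \<in> carrier (mat_ring R n)"
    then show "M \<otimes>\<^bsub>mat_ring R n\<^esub> N \<in> carrier (mat_ring R n)"
      by (auto simp: mat_ring_simps mat_mult_def intro!: finsum_closed add.finprod_one_eqI)
    fix P assume "P \<in> carrier (mat_ring R n)"
    with M N show "M \<otimes>\<^bsub>mat_ring R n\<^esub> N \<otimes>\<^bsub>mat_ring R n\<^esub> P = M \<otimes>\<^bsub>mat_ring R n\<^esub> (N \<otimes>\<^bsub>mat_ring R n\<^esub> P)"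
      by (simp add: mat_ring_simps mat_mult_assoc)
  next
    fix M assume M: "M \<in> carrier (mat_ring R n)"
    then have c: "M i j \<in> carrier R" "n \<le> i \<or> n \<le> j \<Longrightarrow> M i j = \<zero>" for i j
      by (auto simp: mat_ring_simps)
    have "finsum R (\<lambda>k. (if i = k \<and> i < n then \<one> else \<zero>) \<otimes> M k j) {..<n} = M i j" for i j
    \<comment> \<open>Inside the range only \<open>k = i\<close> contributes. Outside it every
      summand is zero, and so is \<open>M i j\<close> by the convention on carriers.\<close>
    proof (cases "i < n")
      case True
      have "finsum R (\<lambda>k. (if i = k \<and> i < n then \<one> else \<zero>) \<otimes> M k j) {..<n}
          = finsum R (\<lambda>k. if i = k then M k j else \<zero>) {..<n}"
        by (intro finsum_cong') (use True c in auto)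
      then show ?thesis using finsum_delta[OF True, of "\<lambda>k. M k j"] c by simp
    qed (use c in \<open>auto intro: add.finprod_one_eqI\<close>)
    then show "\<one>\<^bsub>mat_ring R n\<^esub> \<otimes>\<^bsub>mat_ring R n\<^esub> M = M"
      by (simp add: mat_ring_simps mat_mult_def fun_eq_iff)
    have "finsum R (\<lambda>k. M i k \<otimes> (if k = j \<and> k < n then \<one> else \<zero>)) {..<n} = M i j" for i j
    proof (cases "j < n")
      case True
      have "finsum R (\<lambda>k. M i k \<otimes> (if k = j \<and> k < n then \<one> else \<zero>)) {..<n}
          = finsum R (\<lambda>k. if j = k then M i k else \<zero>) {..<n}"
        by (intro finsum_cong') (use True c in auto)
      then show ?thesis using finsum_delta[OF True, of "\<lambda>k. M i k"] c by simp
    qed (use c in \<open>auto intro: add.finprod_one_eqI\<close>)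
    then show "M \<otimes>\<^bsub>mat_ring R n\<^esub> \<one>\<^bsub>mat_ring R n\<^esub> = M"
      by (simp add: mat_ring_simps mat_mult_def fun_eq_iff)
  qed (auto simp: mat_ring_simps)
next
  fix M N P
  assume "M \<in> carrier (mat_ring R n)" "N \<in> carrier (mat_ring R n)" "P \<in> carrier (mat_ring R n)"
  then have c: "M i j \<in> carrier R" "N i j \<in> carrier R" "P i j \<in> carrier R" for i j
    by (auto simp: mat_ring_simps)
  have "finsum R (\<lambda>k. (M i k \<oplus> N i k) \<otimes> P k j) {..<n}
      = finsum R (\<lambda>k. M i k \<otimes> P k j) {..<n} \<oplus> finsum R (\<lambda>k. N i k \<otimes> P k j) {..<n}" for i j
    by (subst finsum_addf[symmetric]) (auto simp: c l_distr)
  then show "(M \<oplus>\<^bsub>mat_ring R n\<^esub> N) \<otimes>\<^bsub>mat_ring R n\<^esub> P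
      = M \<otimes>\<^bsub>mat_ring R n\<^esub> P \<oplus>\<^bsub>mat_ring R n\<^esub> N \<otimes>\<^bsub>mat_ring R n\<^esub> P"
    by (simp add: mat_ring_simps mat_mult_def fun_eq_iff)
  have "finsum R (\<lambda>k. P i k \<otimes> (M k j \<oplus> N k j)) {..<n}
      = finsum R (\<lambda>k. P i k \<otimes> M k j) {..<n} \<oplus> finsum R (\<lambda>k. P i k \<otimes> N k j) {..<n}" for i j
    by (subst finsum_addf[symmetric]) (auto simp: c r_distr)
  then show "P \<otimes>\<^bsub>mat_ring R n\<^esub> (M \<oplus>\<^bsub>mat_ring R n\<^esub> N)
      = P \<otimes>\<^bsub>mat_ring R n\<^esub> M \<oplus>\<^bsub>mat_ring R n\<^esub> P \<otimes>\<^bsub>mat_ring R n\<^esub> N"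
    by (simp add: mat_ring_simps mat_mult_def fun_eq_iff)
qed

text \<open>Negation is not a field of the ring record but the inverse in its additive monoid, so
  the entrywise formula is recovered from uniqueness of additive inverses.\<close>

lemma mat_ring_minus:
  assumes M: "M \<in> carrier (mat_ring R n)"
  shows "(\<ominus>\<^bsub>mat_ring R n\<^esub> M) i j = \<ominus> (M i j)"
proof -
  interpret S: ring "mat_ring R n" by (rule ring_mat_ring)
  have "\<ominus>\<^bsub>mat_ring R n\<^esub> M \<oplus>\<^bsub>mat_ring R n\<^esub> M = \<zero>\<^bsub>mat_ring R n\<^esub>" using M by (rule S.l_neg)
  then have "(\<ominus>\<^bsub>mat_ring R n\<^esub> M) i j \<oplus> M i j = \<zero>"
    unfolding mat_ring_simps by metis
  moreover have "(\<ominus>\<^bsub>mat_ring R n\<^esub> M) i j \<in> carrier R" "M i j \<in> carrier R"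
    using S.a_inv_closed[OF M] M by (simp_all add: mat_ring_simps(1))
  ultimately show ?thesis by (metis minus_equality minus_minus)
qed

text \<open>If all entries of \<open>M\<close> lie in an ideal \<open>K\<close>, those of the
  \<open>k\<close>-th power lie in \<open>K^k\<close>; a nilpotent \<open>K\<close> exists because
  the square has finitely many entries.\<close>

lemma nilpotent_matrix:
  assumes M: "M \<in> carrier (mat_ring R n)" and nil: "\<And>i j. M i j \<in> nilradical R"
  shows "\<exists>m::nat. M [^]\<^bsub>mat_ring R n\<^esub> m = \<zero>\<^bsub>mat_ring R n\<^esub>"
proof -
  interpret S: ring "mat_ring R n" by (rule ring_mat_ring)
  let ?T = "(\<lambda>(i, j). M i j) ` ({..<n} \<times> {..<n})"
  obtain K m where K: "submod R (carrier R) K" "?T \<subseteq> K" "ideal_pow R K m = {\<zero>}"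
    using finite_nilpotents_in_nilpotent_ideal[of ?T] nil by (auto simp: image_subset_iff)
  have MK: "M i j \<in> K" for i j
    using K(2) M submodD(2)[OF K(1)] by (cases "i < n \<and> j < n") (auto simp: mat_ring_simps)
  have "(M [^]\<^bsub>mat_ring R n\<^esub> k) i j \<in> ideal_pow R K k" for k i j
  proof (induction k arbitrary: i j)
    case 0
    then show ?case by (simp add: mat_ring_simps)
  next
    case (Suc k)
    note P = submod_ideal_pow[OF K(1), of k]
    have "mat_mult R n M (M [^]\<^bsub>mat_ring R n\<^esub> k) i j \<in> ideal_pow R K (Suc k)"
      unfolding mat_mult_def
      using ideal_mult_mem[OF submodD(1)[OF K(1)] submodD(1)[OF P] MK Suc]
      by (intro submod_finsum[OF submod_ideal_pow[OF K(1)]]) auto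
    then show ?case using S.nat_pow_Suc2[OF M, of k] by (simp add: mat_ring_simps)
  qed
  from this[of m] show ?thesis unfolding K(3) by (intro exI[of _ m]) (auto simp: mat_ring_simps fun_eq_iff)
qed

text \<open>Supplies the subring in which the idempotent matrix is lifted, so that the lift keeps
  its entries in \<open>A\<close>.\<close>

lemma subring_mat_ring:
  assumes A: "subring A R"
  shows "subring {M \<in> carrier (mat_ring R n). \<forall>i j. M i j \<in> A} (mat_ring R n)"
proof -
  interpret S: ring "mat_ring R n" by (rule ring_mat_ring)
  note E = subringE[OF A]
  have mult: "mat_mult R n M N i j \<in> A" if "\<And>i j. M i j \<in> A" "\<And>i j. N i j \<in> A" for M N i j
    unfolding mat_mult_def using that E(6)
    by (intro submod_finsum[OF submod_subring[OF A]]) auto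
  show ?thesis
  proof (rule S.subringI)
    fix M N
    assume M: "M \<in> {M \<in> carrier (mat_ring R n). \<forall>i j. M i j \<in> A}"
      and N: "N \<in> {M \<in> carrier (mat_ring R n). \<forall>i j. M i j \<in> A}"
    then show "M \<otimes>\<^bsub>mat_ring R n\<^esub> N \<in> {M \<in> carrier (mat_ring R n). \<forall>i j. M i j \<in> A}"
      using mult S.m_closed[of M N] by (auto simp: mat_ring_simps(2))
    show "M \<oplus>\<^bsub>mat_ring R n\<^esub> N \<in> {M \<in> carrier (mat_ring R n). \<forall>i j. M i j \<in> A}"
      using M N E(7) S.a_closed[of M N] by (auto simp: mat_ring_simps(5))
    show "\<ominus>\<^bsub>mat_ring R n\<^esub> M \<in> {M \<in> carrier (mat_ring R n). \<forall>i j. M i j \<in> A}"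
      using M E(5) S.a_inv_closed[of M] by (auto simp: mat_ring_minus)
  qed (use E in \<open>auto simp: mat_ring_simps\<close>)
qed

end

section \<open>Surjections with nil kernel\<close>

text \<open>Isolates what is used of the map to the reduced ring, so that the arguments never touch
  cosets. The kernel is only required to lie in the nilradical, and \<open>S\<close> need not be
  reduced.\<close>

locale nil_surjection = ring_hom_cring +
  fixes A
  assumes A: "subring A R"
    and surj: "h ` carrier R = carrier S"
    and kernel_nil: "\<And>x. \<lbrakk>x \<in> carrier R; h x = \<zero>\<^bsub>S\<^esub>\<rbrakk> \<Longrightarrow> x \<in> nilradical R"
begin

lemma Ac: "A \<subseteq> carrier R"
  by (rule R.subring_subset[OF A])

lemma image_subring: "subring (h ` A) S"
  by (rule ring.img_is_subring[OF A])

lemma submod_image: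
  assumes L: "submod R A L"
  shows "submod S (h ` A) (h ` L)"
proof -
  note D = R.submodD[OF L]
  have "h x \<oplus>\<^bsub>S\<^esub> h y \<in> h ` L" if "x \<in> L" "y \<in> L" for x y
    using that D(1,3) by (intro image_eqI[of _ _ "x \<oplus>\<^bsub>R\<^esub> y"]) (auto simp: subset_iff)
  moreover have "h a \<otimes>\<^bsub>S\<^esub> h x \<in> h ` L" if "a \<in> A" "x \<in> L" for a x
    using that D(1,4) Ac by (intro image_eqI[of _ _ "a \<otimes>\<^bsub>R\<^esub> x"]) (auto simp: subset_iff)
  moreover have "\<zero>\<^bsub>S\<^esub> \<in> h ` L" using D by (intro image_eqI[of _ _ "\<zero>\<^bsub>R\<^esub>"]) auto
  ultimately show ?thesis unfolding submod_def using D(1) by auto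
qed

lemma image_ideal_mult:
  assumes L: "L \<subseteq> carrier R" and M: "M \<subseteq> carrier R"
  shows "h ` ideal_mult R L M = ideal_mult S (h ` L) (h ` M)"
proof
  have hL: "h ` L \<subseteq> carrier S" and hM: "h ` M \<subseteq> carrier S" using L M by auto
  show "h ` ideal_mult R L M \<subseteq> ideal_mult S (h ` L) (h ` M)"
  proof
    fix t assume "t \<in> h ` ideal_mult R L M"
    then obtain s where s: "s \<in> ideal_mult R L M" "t = h s" by blast
    have "s \<in> carrier R \<and> h s \<in> ideal_mult S (h ` L) (h ` M)"
      using s(1) L M
    proof (induction rule: R.ideal_mult_induct)
      case zero
      then show ?case using S.ideal_mult_zero by simp
    next
      case (step s x y)
      then have "x \<in> carrier R" "y \<in> carrier R" using L M by auto
      then have "h (s \<oplus>\<^bsub>R\<^esub> x \<otimes>\<^bsub>R\<^esub> y) = h s \<oplus>\<^bsub>S\<^esub> h x \<otimes>\<^bsub>S\<^esub> h y" using step by simp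
      then show ?case using S.ideal_mult_snoc[OF hL hM] step by auto
    qed
    then show "t \<in> ideal_mult S (h ` L) (h ` M)" using s by blast
  qed
  show "ideal_mult S (h ` L) (h ` M) \<subseteq> h ` ideal_mult R L M"
  proof
    fix t assume "t \<in> ideal_mult S (h ` L) (h ` M)"
    then have "t \<in> carrier S \<and> t \<in> h ` ideal_mult R L M"
      using hL hM
    proof (induction rule: S.ideal_mult_induct)
      case zero
      then show ?case using R.ideal_mult_zero by (intro image_eqI[of _ _ "\<zero>\<^bsub>R\<^esub>"]) auto
    next
      case (step t x' y')
      then obtain s x y where "s \<in> ideal_mult R L M" "t = h s" "x \<in> L" "x' = h x" "y \<in> M" "y' = h y"
        by blast
      moreover have "s \<in> carrier R"
        using R.ideal_mult_induct[OF \<open>s \<in> ideal_mult R L M\<close> L M, of "\<lambda>_. True"] by simp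
      ultimately show ?case
        using R.ideal_mult_snoc[OF L M, of s x y] L M
        by (intro conjI image_eqI[of _ _ "s \<oplus>\<^bsub>R\<^esub> x \<otimes>\<^bsub>R\<^esub> y"]) (auto simp: subset_iff)
    qed
    then show "t \<in> h ` ideal_mult R L M" ..
  qed
qed

lemma image_principal:
  assumes "x \<in> carrier R"
  shows "h ` (\<lambda>a. a \<otimes>\<^bsub>R\<^esub> x) ` A = (\<lambda>a. a \<otimes>\<^bsub>S\<^esub> h x) ` h ` A"
proof -
  have "h (a \<otimes>\<^bsub>R\<^esub> x) = h a \<otimes>\<^bsub>S\<^esub> h x" if "a \<in> A" for a using that Ac assms by auto
  then show ?thesis by (simp add: image_image)
qed

text \<open>\<open>1 - a\<close> lies in the kernel, hence is nilpotent, and the geometric series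
  inverts \<open>a\<close> inside \<open>T\<close>. Both \<open>T = carrier R\<close> and
  \<open>T = A\<close> are used: the first for lifting units, the second for keeping coefficients in
  \<open>A\<close>.\<close>

lemma lift_one:
  assumes a: "a \<in> T" and T: "subring T R" and "h a = \<one>\<^bsub>S\<^esub>"
  shows "\<exists>w\<in>T. a \<otimes>\<^bsub>R\<^esub> w = \<one>\<^bsub>R\<^esub>"
proof -
  have ac: "a \<in> carrier R" using a R.subring_subset[OF T] by blast
  let ?z = "\<one>\<^bsub>R\<^esub> \<ominus>\<^bsub>R\<^esub> a"
  have "h ?z = \<zero>\<^bsub>S\<^esub>" using ac assms(3) by (simp add: R.minus_eq S.r_neg)
  then obtain k :: nat where k: "?z [^]\<^bsub>R\<^esub> k = \<zero>\<^bsub>R\<^esub>"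
    using kernel_nil[of ?z] ac by (auto simp: nilradical_def)
  have "?z \<in> T" using subringE[OF T] a by (simp add: R.minus_eq)
  moreover have "\<one>\<^bsub>R\<^esub> \<ominus>\<^bsub>R\<^esub> ?z = a" using ac by algebra
  ultimately show ?thesis using R.unipotent_inverse[OF T _ k] by metis
qed

text \<open>For \<open>y\<close> over the inverse of \<open>h x\<close>, the product
  \<open>xy\<close> maps to 1 and is thus invertible, so \<open>x\<close> is invertible as
  well.\<close>

lemma lift_unit:
  assumes x: "x \<in> carrier R" and u: "h x \<in> Units S"
  shows "x \<in> Units R"
proof -
  obtain y where y: "y \<in> carrier R" "h y = inv\<^bsub>S\<^esub> h x"
    using surj S.Units_inv_closed[OF u] by (metis imageE)
  have "h (x \<otimes>\<^bsub>R\<^esub> y) = \<one>\<^bsub>S\<^esub>" using x y u by simp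
  then obtain w where w: "w \<in> carrier R" "x \<otimes>\<^bsub>R\<^esub> y \<otimes>\<^bsub>R\<^esub> w = \<one>\<^bsub>R\<^esub>"
    using lift_one[OF _ R.carrier_is_subring, of "x \<otimes>\<^bsub>R\<^esub> y"] x y by auto
  then have "x \<otimes>\<^bsub>R\<^esub> (y \<otimes>\<^bsub>R\<^esub> w) = \<one>\<^bsub>R\<^esub>" using x y by (simp add: R.m_assoc)
  then show ?thesis
    using x y w R.m_comm[of x "y \<otimes>\<^bsub>R\<^esub> w"] unfolding Units_def by (auto intro!: bexI[of _ "y \<otimes>\<^bsub>R\<^esub> w"])
qed

lemma unit_image:
  assumes "x \<in> Units R"
  shows "h x \<in> Units S"
proof -
  have c: "x \<in> carrier R" "inv\<^bsub>R\<^esub> x \<in> carrier R" using assms by auto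
  have "h x \<otimes>\<^bsub>S\<^esub> h (inv\<^bsub>R\<^esub> x) = \<one>\<^bsub>S\<^esub>" "h (inv\<^bsub>R\<^esub> x) \<otimes>\<^bsub>S\<^esub> h x = \<one>\<^bsub>S\<^esub>"
    using hom_mult[OF c] hom_mult[OF c(2,1)] assms by simp_all
  then show ?thesis unfolding Units_def using c by auto
qed

section \<open>Images and lifts of invertible ideals\<close>

lemma invertible_image:
  assumes "invertible_ideal R A L"
  shows "invertible_ideal S (h ` A) (h ` L)"
proof -
  obtain L' where L: "submod R A L" "submod R A L'" "ideal_mult R L L' = A"
    using assms unfolding invertible_ideal_def by blast
  then have "ideal_mult S (h ` L) (h ` L') = h ` A"
    using image_ideal_mult[OF R.submodD(1)[OF L(1)] R.submodD(1)[OF L(2)]] by simp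
  then show ?thesis unfolding invertible_ideal_def using submod_image L by blast
qed

lemma principal_lift:
  assumes L: "invertible_ideal R A L"
    and y: "y \<in> Units S" and Ly: "h ` L = (\<lambda>a. a \<otimes>\<^bsub>S\<^esub> y) ` h ` A"
  shows "\<exists>x\<in>Units R. L = (\<lambda>a. a \<otimes>\<^bsub>R\<^esub> x) ` A"
proof -
  obtain L' where L: "submod R A L" and L': "submod R A L'" "ideal_mult R L L' = A"
    using L unfolding invertible_ideal_def by blast
  note Lc = R.submodD(1)[OF L] and L'c = R.submodD(1)[OF L'(1)]
  note B = image_subring
  have Bc: "h ` A \<subseteq> carrier S" using Ac by auto
  have yc: "y \<in> carrier S" and y'c: "inv\<^bsub>S\<^esub> y \<in> carrier S" using y by auto
  have "y \<in> h ` L"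
    unfolding Ly using subringE(3)[OF B] yc by (intro image_eqI[of _ _ "\<one>\<^bsub>S\<^esub>"]) auto
  then obtain l where l: "l \<in> L" "h l = y" by blast
  have "inv\<^bsub>S\<^esub> y \<in> h ` L'"
  proof -
    \<comment> \<open>\<open>?N\<close> collects the \<open>w\<close> with \<open>y^-1 w\<close> in
      the image of \<open>L'\<close>. It is a submodule containing all products of \<open>?P\<close>
      with that image, hence all of \<open>h(A)\<close>; taking \<open>w = 1\<close> gives the
      claim.\<close>
    let ?P = "(\<lambda>a. a \<otimes>\<^bsub>S\<^esub> y) ` h ` A" and ?N = "{w \<in> carrier S. inv\<^bsub>S\<^esub> y \<otimes>\<^bsub>S\<^esub> w \<in> h ` L'}"
    note D = S.submodD[OF submod_image[OF L'(1)]]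
    have N: "submod S (h ` A) ?N"
      unfolding submod_def
    proof (intro conjI ballI)
      fix a w assume a: "a \<in> h ` A" and w: "w \<in> ?N"
      then have c: "a \<in> carrier S" "w \<in> carrier S" using Bc by auto
      have "inv\<^bsub>S\<^esub> y \<otimes>\<^bsub>S\<^esub> (a \<otimes>\<^bsub>S\<^esub> w) = a \<otimes>\<^bsub>S\<^esub> (inv\<^bsub>S\<^esub> y \<otimes>\<^bsub>S\<^esub> w)"
        using c y'c by (simp add: S.m_lcomm)
      also have "\<dots> \<in> h ` L'" using D(4) a w by blast
      finally show "a \<otimes>\<^bsub>S\<^esub> w \<in> ?N" using c by simp
    qed (use D y'c in \<open>auto simp: S.r_distr\<close>)
    have "p \<otimes>\<^bsub>S\<^esub> q \<in> ?N" if p: "p \<in> ?P" and q: "q \<in> h ` L'" for p q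
    proof -
      obtain b where b: "b \<in> h ` A" "p = b \<otimes>\<^bsub>S\<^esub> y" using p by blast
      have c: "b \<in> carrier S" "q \<in> carrier S" using b q Bc D(1) by auto
      have "inv\<^bsub>S\<^esub> y \<otimes>\<^bsub>S\<^esub> (b \<otimes>\<^bsub>S\<^esub> y \<otimes>\<^bsub>S\<^esub> q) = (y \<otimes>\<^bsub>S\<^esub> inv\<^bsub>S\<^esub> y) \<otimes>\<^bsub>S\<^esub> (b \<otimes>\<^bsub>S\<^esub> q)"
        using c yc y'c by algebra
      also have "\<dots> = b \<otimes>\<^bsub>S\<^esub> q" using y c by simp
      also have "\<dots> \<in> h ` L'" using D(4) b(1) q by blast
      finally show ?thesis using c yc b(2) by simp
    qed
    moreover have "?P \<subseteq> carrier S" using Bc yc by auto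
    ultimately have "ideal_mult S ?P (h ` L') \<subseteq> ?N"
      by (intro S.ideal_mult_subset[OF _ D(1) N]) auto
    moreover have "ideal_mult S ?P (h ` L') = h ` A"
      using image_ideal_mult[OF Lc L'c] L'(2) Ly by simp
    ultimately have "\<one>\<^bsub>S\<^esub> \<in> ?N" using subringE(3)[OF B] by blast
    then show ?thesis using y'c by simp
  qed
  then obtain l' where l': "l' \<in> L'" "h l' = inv\<^bsub>S\<^esub> y" by force
  have c: "l \<in> carrier R" "l' \<in> carrier R" using l l' Lc L'c by auto
  have mem: "z \<otimes>\<^bsub>R\<^esub> l' \<in> A" if "z \<in> L" for z
    using R.ideal_mult_mem[OF Lc L'c that l'(1)] L'(2) by simp
  have "h (l \<otimes>\<^bsub>R\<^esub> l') = \<one>\<^bsub>S\<^esub>" using c l(2) l'(2) y by simp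
  \<comment> \<open>It matters that \<open>w\<close> lies in \<open>A\<close>: the coefficient
    \<open>z l' w\<close> of \<open>l\<close> below must belong to \<open>A\<close>.\<close>
  then obtain w where w: "w \<in> A" "l \<otimes>\<^bsub>R\<^esub> l' \<otimes>\<^bsub>R\<^esub> w = \<one>\<^bsub>R\<^esub>"
    using lift_one[OF mem[OF l(1)] A] by blast
  have "L \<subseteq> (\<lambda>a. a \<otimes>\<^bsub>R\<^esub> l) ` A"
  proof
    fix z assume z: "z \<in> L"
    have zc: "z \<in> carrier R" "w \<in> carrier R" using z Lc w Ac by auto
    have "z = z \<otimes>\<^bsub>R\<^esub> (l \<otimes>\<^bsub>R\<^esub> l' \<otimes>\<^bsub>R\<^esub> w)" using w(2) zc by simp
    also have "\<dots> = (z \<otimes>\<^bsub>R\<^esub> l' \<otimes>\<^bsub>R\<^esub> w) \<otimes>\<^bsub>R\<^esub> l" using zc c by algebra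
    finally show "z \<in> (\<lambda>a. a \<otimes>\<^bsub>R\<^esub> l) ` A" using mem[OF z] w(1) subringE(6)[OF A] by blast
  qed
  moreover have "(\<lambda>a. a \<otimes>\<^bsub>R\<^esub> l) ` A \<subseteq> L" using R.submodD(4)[OF L _ l(1)] by blast
  ultimately show ?thesis using lift_unit[OF c(1)] l(2) y by blast
qed

lemma invertible_ideal_lift:
  assumes "invertible_ideal S (h ` A) J"
  shows "\<exists>L. invertible_ideal R A L \<and> h ` L = J"
proof -
  obtain J' where J: "submod S (h ` A) J" and J': "submod S (h ` A) J'" "ideal_mult S J J' = h ` A"
    using assms unfolding invertible_ideal_def by blast
  note Jc = S.submodD(1)[OF J] and J'c = S.submodD(1)[OF J'(1)]
  have "\<one>\<^bsub>S\<^esub> \<in> ideal_mult S J J'" using J'(2) subringE(3)[OF image_subring] by simp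
  then obtain n :: nat and x0 y0 where one0: "\<one>\<^bsub>S\<^esub> = finsum S (\<lambda>i. x0 i \<otimes>\<^bsub>S\<^esub> y0 i) {..<n}"
    and xy0: "\<forall>i<n. x0 i \<in> J \<and> y0 i \<in> J'"
    unfolding ideal_mult_def by blast
  \<comment> \<open>Both families are extended by zero beyond \<open>n\<close>. They then stay in
    \<open>J\<close> and \<open>J'\<close> at every index, and the products \<open>y i\<close>,
    \<open>x j\<close> vanish outside the square as \<open>mat_ring\<close> demands.\<close>
  define x where "x i = (if i < n then x0 i else \<zero>\<^bsub>S\<^esub>)" for i
  define y where "y i = (if i < n then y0 i else \<zero>\<^bsub>S\<^esub>)" for i
  have xJ: "x i \<in> J" and yJ: "y i \<in> J'" for i
    using xy0 S.submodD(2)[OF J] S.submodD(2)[OF J'(1)] unfolding x_def y_def by auto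
  then have xc [simp]: "x i \<in> carrier S" and yc [simp]: "y i \<in> carrier S" for i
    using Jc J'c by auto
  have xy: "finsum S (\<lambda>i. x i \<otimes>\<^bsub>S\<^esub> y i) {..<n} = \<one>\<^bsub>S\<^esub>"
    unfolding one0 using xy0 Jc J'c by (intro S.finsum_cong') (auto simp: x_def y_def)
  \<comment> \<open>Used in three ways: \<open>p = y i\<close>, \<open>q = x j\<close> shows that
    the matrix of products is idempotent, \<open>p = 1\<close> that it fixes the row
    \<open>x\<close>, and \<open>q = 1\<close> that it fixes the column \<open>y\<close>.\<close>
  have sum_xy: "finsum S (\<lambda>k. p \<otimes>\<^bsub>S\<^esub> x k \<otimes>\<^bsub>S\<^esub> (y k \<otimes>\<^bsub>S\<^esub> q)) {..<n} = p \<otimes>\<^bsub>S\<^esub> q"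
    if pq: "p \<in> carrier S" "q \<in> carrier S" for p q
  proof -
    have "finsum S (\<lambda>k. p \<otimes>\<^bsub>S\<^esub> x k \<otimes>\<^bsub>S\<^esub> (y k \<otimes>\<^bsub>S\<^esub> q)) {..<n}
        = finsum S (\<lambda>k. (p \<otimes>\<^bsub>S\<^esub> q) \<otimes>\<^bsub>S\<^esub> (x k \<otimes>\<^bsub>S\<^esub> y k)) {..<n}"
      using pq by (intro S.finsum_cong') (auto simp: S.m_ac)
    also have "\<dots> = (p \<otimes>\<^bsub>S\<^esub> q) \<otimes>\<^bsub>S\<^esub> finsum S (\<lambda>k. x k \<otimes>\<^bsub>S\<^esub> y k) {..<n}"
      using pq by (intro S.finsum_rdistr[symmetric]) auto
    finally show ?thesis using xy pq by simp
  qed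
  have "\<forall>i. \<exists>r\<in>carrier R. h r = x i" "\<forall>i. \<exists>r\<in>carrier R. h r = y i"
    using surj xc yc by (metis imageE)+
  then obtain b c where b [simp]: "\<And>i. b i \<in> carrier R" "\<And>i. h (b i) = x i"
    and c [simp]: "\<And>i. c i \<in> carrier R" "\<And>i. h (c i) = y i"
    by metis
  have "\<exists>a\<in>A. h a = y i \<otimes>\<^bsub>S\<^esub> x j \<and> (n \<le> i \<or> n \<le> j \<longrightarrow> a = \<zero>\<^bsub>R\<^esub>)" for i j
  proof (cases "n \<le> i \<or> n \<le> j")
    case True
    then have "y i \<otimes>\<^bsub>S\<^esub> x j = \<zero>\<^bsub>S\<^esub>" using xc[of j] yc[of i] by (auto simp: x_def y_def)
    then show ?thesis using subringE(2)[OF A] by (intro bexI[of _ "\<zero>\<^bsub>R\<^esub>"]) auto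
  next
    case False
    have "y i \<otimes>\<^bsub>S\<^esub> x j \<in> h ` A"
      using S.ideal_mult_mem[OF Jc J'c xJ yJ, of j i] J'(2) S.m_comm[OF yc xc] by simp
    then show ?thesis using False by auto
  qed
  then obtain a where a: "\<And>i j. a i j \<in> A" "\<And>i j. h (a i j) = y i \<otimes>\<^bsub>S\<^esub> x j"
    "\<And>i j. n \<le> i \<or> n \<le> j \<Longrightarrow> a i j = \<zero>\<^bsub>R\<^esub>"
    by metis
  let ?M = "mat_ring R n"
  interpret M: ring ?M by (rule R.ring_mat_ring)
  note MS = R.mat_ring_simps
  define T where "T = {U \<in> carrier ?M. \<forall>i j. U i j \<in> A}"
  have T: "subring T ?M" unfolding T_def by (rule R.subring_mat_ring[OF A])
  note TE = subringE[OF T]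
  have TU: "U i j \<in> A" "U i j \<in> carrier R" if "U \<in> T" for U i j
    using that Ac unfolding T_def by auto
  have h_mult: "h (mat_mult R n U V i j) = finsum S (\<lambda>k. h (U i k) \<otimes>\<^bsub>S\<^esub> h (V k j)) {..<n}"
    if "\<And>i j. U i j \<in> carrier R" "\<And>i j. V i j \<in> carrier R" for U V i j
  proof -
    have "h (mat_mult R n U V i j) = finsum S (h \<circ> (\<lambda>k. U i k \<otimes>\<^bsub>R\<^esub> V k j)) {..<n}"
      unfolding mat_mult_def using that by (intro hom_finsum) auto
    also have "\<dots> = finsum S (\<lambda>k. h (U i k) \<otimes>\<^bsub>S\<^esub> h (V k j)) {..<n}"
      using that by (intro S.finsum_cong') auto
    finally show ?thesis .
  qed
  have aT: "a \<in> T" unfolding T_def MS using a Ac by auto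
  then have aM: "a \<in> carrier ?M" using TE(1) by blast
  \<comment> \<open>The lifting lemma takes complementary elements. Their product
    \<open>?d = a - a^2\<close> measures how far the lift \<open>a\<close> is from being idempotent,
    and its entries lie in the kernel.\<close>
  define a' where "a' = \<one>\<^bsub>?M\<^esub> \<ominus>\<^bsub>?M\<^esub> a"
  have a'T: "a' \<in> T" unfolding a'_def using TE aT by (simp add: M.minus_eq)
  have aa': "a \<oplus>\<^bsub>?M\<^esub> a' = \<one>\<^bsub>?M\<^esub>" unfolding a'_def using aM by algebra
  let ?d = "a \<otimes>\<^bsub>?M\<^esub> a'"
  have dT: "?d \<in> T" using TE(6) aT a'T by blast
  then have dM: "?d \<in> carrier ?M" using TE(1) by blast
  have hd: "h (?d i j) = \<zero>\<^bsub>S\<^esub>" for i j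
  proof -
    have "?d = a \<ominus>\<^bsub>?M\<^esub> a \<otimes>\<^bsub>?M\<^esub> a"
      unfolding a'_def using aM by (simp add: M.minus_eq M.r_distr M.r_minus)
    then have "a \<otimes>\<^bsub>?M\<^esub> a \<oplus>\<^bsub>?M\<^esub> ?d = a"
      using aM M.r_neg1 by (simp add: M.minus_eq M.a_lcomm M.r_neg)
    then have "(a \<otimes>\<^bsub>?M\<^esub> a) i j \<oplus>\<^bsub>R\<^esub> ?d i j = a i j"
      unfolding MS(5) by (rule fun_cong[OF fun_cong])
    then have "h ((a \<otimes>\<^bsub>?M\<^esub> a) i j) \<oplus>\<^bsub>S\<^esub> h (?d i j) = h (a i j)"
      using hom_add[OF TU(2)[OF TE(6)[OF aT aT]] TU(2)[OF dT], of i j i j] by simp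
    moreover have "h ((a \<otimes>\<^bsub>?M\<^esub> a) i j) = h (a i j)"
      unfolding MS(2) using h_mult[OF TU(2)[OF aT] TU(2)[OF aT]] sum_xy[OF yc xc] a(2) by simp
    moreover have "h (?d i j) \<in> carrier S" "h (a i j) \<in> carrier S" using TU(2) dT aT by auto
    ultimately show ?thesis using S.add.r_cancel_one'[of "h (a i j)" "h (?d i j)"] by simp
  qed
  obtain m :: nat where "?d [^]\<^bsub>?M\<^esub> m = \<zero>\<^bsub>?M\<^esub>"
    using R.nilpotent_matrix[OF dM] kernel_nil[OF TU(2)[OF dT] hd] by blast
  then obtain e w where eT: "e \<in> T" and wT: "w \<in> T" and ee: "e \<otimes>\<^bsub>?M\<^esub> e = e"
    and e_eq: "e = a \<oplus>\<^bsub>?M\<^esub> ?d \<otimes>\<^bsub>?M\<^esub> w"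
    using M.lift_idempotent[OF T aT a'T aa'] by blast
  have eM: "e \<in> carrier ?M" using eT TE(1) by blast
  note ec [simp] = TU(2)[OF eT]
  \<comment> \<open>The correction \<open>?d w\<close> maps to zero, so \<open>e\<close> lies over
    the same matrix as \<open>a\<close>; this is why the lift is kept in the form
    \<open>e = a + ?d w\<close>.\<close>
  have he: "h (e i j) = y i \<otimes>\<^bsub>S\<^esub> x j" for i j
  proof -
    have "e i j = a i j \<oplus>\<^bsub>R\<^esub> mat_mult R n ?d w i j"
      using fun_cong[OF fun_cong[OF e_eq, of i], of j] unfolding MS(2,5) .
    moreover have "h (mat_mult R n ?d w i j) = \<zero>\<^bsub>S\<^esub>"
      using h_mult[OF TU(2)[OF dT] TU(2)[OF wT]] TU(2)[OF wT] hd by simp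
    moreover have "mat_mult R n ?d w i j \<in> carrier R"
      by (intro R.mat_mult_closed TU(2)[OF dT] TU(2)[OF wT])
    ultimately show ?thesis using a(2) TU(2)[OF aT] by simp
  qed
  \<comment> \<open>These are the row \<open>bE\<close> and the column \<open>Ec\<close>; the index
    0 is a dummy, since a row does not depend on its first index nor a column on its second. As
    \<open>e\<close> is idempotent it fixes both, and their images are still \<open>x\<close> and
    \<open>y\<close>.\<close>
  define b' where "b' j = mat_mult R n (\<lambda>_. b) e 0 j" for j
  define c' where "c' i = mat_mult R n e (\<lambda>i _. c i) i 0" for i
  have b'c [simp]: "b' j \<in> carrier R" and c'c [simp]: "c' j \<in> carrier R" for j
    unfolding b'_def c'_def by auto
  have b'_row: "mat_mult R n (\<lambda>_. b) e = (\<lambda>_. b')"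
    unfolding b'_def by (simp add: mat_mult_def fun_eq_iff)
  have c'_col: "mat_mult R n e (\<lambda>i _. c i) = (\<lambda>i _. c' i)"
    unfolding c'_def by (simp add: mat_mult_def fun_eq_iff)
  have b'e: "mat_mult R n (\<lambda>_. b') e = (\<lambda>_. b')"
    using R.mat_mult_assoc[of "\<lambda>_. b" e e n n] ee unfolding b'_row MS(2) by (simp add: b'_row)
  have ec': "mat_mult R n e (\<lambda>i _. c' i) = (\<lambda>i _. c' i)"
    using R.mat_mult_assoc[of e e "\<lambda>i _. c i" n n] ee unfolding c'_col MS(2) by (simp add: c'_col)
  have hb': "h (b' j) = x j" for j
    using h_mult[of "\<lambda>_. b" e 0 j] sum_xy[of "\<one>\<^bsub>S\<^esub>" "x j"] unfolding b'_def by (simp add: he)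
  have hc': "h (c' i) = y i" for i
    using h_mult[of e "\<lambda>i _. c i" i 0] sum_xy[of "y i" "\<one>\<^bsub>S\<^esub>"] unfolding c'_def by (simp add: he)
  \<comment> \<open>The scalar \<open>b'c'\<close> lies over the sum of the \<open>x i y i\<close>,
    which is 1. It is therefore a unit, and dividing the column by it makes the product of row and
    column exactly 1.\<close>
  define u where "u = mat_mult R n (\<lambda>_. b') (\<lambda>i _. c' i) 0 0"
  have uc: "u \<in> carrier R" unfolding u_def by auto
  have hu: "h u = \<one>\<^bsub>S\<^esub>"
    using h_mult[of "\<lambda>_. b'" "\<lambda>i _. c' i" 0 0] xy unfolding u_def by (simp add: hb' hc')
  then have u: "u \<in> Units R" using lift_unit[OF uc] by simp
  define v where "v = inv\<^bsub>R\<^esub> u"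
  have vc [simp]: "v \<in> carrier R" and uv: "u \<otimes>\<^bsub>R\<^esub> v = \<one>\<^bsub>R\<^esub>" unfolding v_def using u by auto
  have hv: "h v = \<one>\<^bsub>S\<^esub>"
    using hom_mult[OF uc vc] uv hu by simp
  define c2 where "c2 i = v \<otimes>\<^bsub>R\<^esub> c' i" for i
  have c2c [simp]: "c2 i \<in> carrier R" for i unfolding c2_def by simp
  have hc2: "h (c2 i) = y i" for i unfolding c2_def by (simp add: hv hc')
  have b'c2: "finsum R (\<lambda>i. b' i \<otimes>\<^bsub>R\<^esub> c2 i) {..<n} = \<one>\<^bsub>R\<^esub>"
  proof -
    have "finsum R (\<lambda>i. b' i \<otimes>\<^bsub>R\<^esub> c2 i) {..<n} = finsum R (\<lambda>i. v \<otimes>\<^bsub>R\<^esub> (b' i \<otimes>\<^bsub>R\<^esub> c' i)) {..<n}"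
      unfolding c2_def by (intro R.finsum_cong') (auto simp: R.m_lcomm)
    also have "\<dots> = v \<otimes>\<^bsub>R\<^esub> u"
      unfolding u_def mat_mult_def by (intro R.finsum_rdistr[symmetric]) auto
    finally show ?thesis using uv R.m_comm[OF uc vc] by simp
  qed
  \<comment> \<open>Column times row: since row times column is 1, \<open>F\<close> is idempotent,
    and since \<open>e\<close> fixes row and column, \<open>eF = F = Fe\<close>.\<close>
  define F where "F i j = c2 i \<otimes>\<^bsub>R\<^esub> b' j" for i j
  have Fc [simp]: "F i j \<in> carrier R" for i j unfolding F_def by simp
  have e0: "e i j = \<zero>\<^bsub>R\<^esub>" if "n \<le> i \<or> n \<le> j" for i j using eM that unfolding MS(1) by blast
  have FM: "F \<in> carrier ?M"
  proof -
    have "b' j = \<zero>\<^bsub>R\<^esub>" if "n \<le> j" for j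
      unfolding b'_def mat_mult_def using e0 that by simp
    moreover have "c' j = \<zero>\<^bsub>R\<^esub>" if "n \<le> j" for j
      unfolding c'_def mat_mult_def using e0 that by simp
    ultimately show ?thesis unfolding MS(1) F_def c2_def by auto
  qed
  have eF: "e \<otimes>\<^bsub>?M\<^esub> F = F"
  proof -
    have "mat_mult R n e F i j = F i j" for i j
    proof -
      have "mat_mult R n e F i j = finsum R (\<lambda>k. (v \<otimes>\<^bsub>R\<^esub> b' j) \<otimes>\<^bsub>R\<^esub> (e i k \<otimes>\<^bsub>R\<^esub> c' k)) {..<n}"
        unfolding mat_mult_def F_def c2_def by (intro R.finsum_cong') (auto simp: R.m_ac)
      also have "\<dots> = (v \<otimes>\<^bsub>R\<^esub> b' j) \<otimes>\<^bsub>R\<^esub> mat_mult R n e (\<lambda>i _. c' i) i 0"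
        unfolding mat_mult_def by (intro R.finsum_rdistr[symmetric]) auto
      finally show ?thesis unfolding ec' F_def c2_def by (simp add: R.m_ac)
    qed
    then show ?thesis unfolding MS(2) by blast
  qed
  have Fe: "F \<otimes>\<^bsub>?M\<^esub> e = F"
  proof -
    have "mat_mult R n F e i j = F i j" for i j
    proof -
      have "mat_mult R n F e i j = finsum R (\<lambda>k. c2 i \<otimes>\<^bsub>R\<^esub> (b' k \<otimes>\<^bsub>R\<^esub> e k j)) {..<n}"
        unfolding mat_mult_def F_def by (intro R.finsum_cong') (auto simp: R.m_ac)
      also have "\<dots> = c2 i \<otimes>\<^bsub>R\<^esub> mat_mult R n (\<lambda>_. b') e 0 j"
        unfolding mat_mult_def by (intro R.finsum_rdistr[symmetric]) auto
      finally show ?thesis unfolding b'e F_def .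
    qed
    then show ?thesis unfolding MS(2) by blast
  qed
  have FF: "F \<otimes>\<^bsub>?M\<^esub> F = F"
  proof -
    have "mat_mult R n F F i j = F i j" for i j
    proof -
      have "mat_mult R n F F i j = finsum R (\<lambda>k. (c2 i \<otimes>\<^bsub>R\<^esub> b' j) \<otimes>\<^bsub>R\<^esub> (b' k \<otimes>\<^bsub>R\<^esub> c2 k)) {..<n}"
        unfolding mat_mult_def F_def by (intro R.finsum_cong') (auto simp: R.m_ac)
      also have "\<dots> = (c2 i \<otimes>\<^bsub>R\<^esub> b' j) \<otimes>\<^bsub>R\<^esub> finsum R (\<lambda>k. b' k \<otimes>\<^bsub>R\<^esub> c2 k) {..<n}"
        by (intro R.finsum_rdistr[symmetric]) auto
      finally show ?thesis using b'c2 unfolding F_def by simp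
    qed
    then show ?thesis unfolding MS(2) by blast
  qed
  have eF_eq: "e = F"
  proof -
    define D where "D = e \<ominus>\<^bsub>?M\<^esub> F"
    have DM: "D \<in> carrier ?M" unfolding D_def using eM FM by simp
    have "D \<otimes>\<^bsub>?M\<^esub> D = e \<otimes>\<^bsub>?M\<^esub> e \<ominus>\<^bsub>?M\<^esub> e \<otimes>\<^bsub>?M\<^esub> F \<ominus>\<^bsub>?M\<^esub> F \<otimes>\<^bsub>?M\<^esub> e \<oplus>\<^bsub>?M\<^esub> F \<otimes>\<^bsub>?M\<^esub> F"
      unfolding D_def using eM FM by algebra
    also have "\<dots> = D" unfolding ee eF Fe FF D_def using eM FM by (simp add: M.minus_eq M.a_assoc M.l_neg)
    finally have DD: "D \<otimes>\<^bsub>?M\<^esub> D = D" .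
    \<comment> \<open>Successor exponents are used because the zeroth power is the identity; the
      nilpotency exponent obtained below might be 0.\<close>
    have pow: "D [^]\<^bsub>?M\<^esub> Suc k = D" for k :: nat
      by (induction k) (use DM DD in auto)
    have "D i j \<in> nilradical R" for i j
    proof (rule kernel_nil)
      have D: "D i j = e i j \<ominus>\<^bsub>R\<^esub> F i j"
        unfolding D_def M.minus_eq MS(5) R.mat_ring_minus[OF FM] R.minus_eq ..
      then show "D i j \<in> carrier R" by simp
      have "h (F i j) = y i \<otimes>\<^bsub>S\<^esub> x j" unfolding F_def by (simp add: hc2 hb')
      then show "h (D i j) = \<zero>\<^bsub>S\<^esub>" unfolding D R.minus_eq by (simp add: he S.r_neg)
    qed
    then obtain k :: nat where "D [^]\<^bsub>?M\<^esub> k = \<zero>\<^bsub>?M\<^esub>" using R.nilpotent_matrix[OF DM] by blast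
    then have "D [^]\<^bsub>?M\<^esub> Suc k = \<zero>\<^bsub>?M\<^esub>" using DM by simp
    then have "D = \<zero>\<^bsub>?M\<^esub>" using pow by simp
    then show ?thesis unfolding D_def using eM FM by (simp add: M.r_right_minus_eq)
  qed
  \<comment> \<open>The purpose of the matrix argument: \<open>b'\<close> and \<open>c2\<close> have
    entries in \<open>R\<close> only, yet their products are entries of \<open>e\<close> and so lie
    in \<open>A\<close>.\<close>
  have cb: "c2 i \<otimes>\<^bsub>R\<^esub> b' j \<in> A" for i j
    using TU(1)[OF eT] eF_eq F_def by metis
  define L where "L = ideal_mult R A (range b')"
  define L' where "L' = ideal_mult R A (range c2)"
  note AE = subringE[OF A]
  have rb: "range b' \<subseteq> carrier R" and rc: "range c2 \<subseteq> carrier R" by auto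
  have L: "submod R A L" and L': "submod R A L'"
    unfolding L_def L'_def by (auto intro!: R.submod_ideal_mult Ac R.submod_subring A)
  note Lc = R.submodD(1)[OF L] and L'c = R.submodD(1)[OF L']
  have b'L: "b' i \<in> L" and c2L: "c2 i \<in> L'" for i
    using R.ideal_mult_mem[OF Ac rb AE(3), of "b' i"] R.ideal_mult_mem[OF Ac rc AE(3), of "c2 i"]
    unfolding L_def L'_def by auto
  \<comment> \<open>Products of spans are reduced to products of generators in two rounds, first for
    the left factor and then, in \<open>st\<close>, for the right one.\<close>
  have sc: "s \<otimes>\<^bsub>R\<^esub> c2 i \<in> A" if "s \<in> L" for s i
  proof -
    have "s \<in> carrier R \<and> s \<otimes>\<^bsub>R\<^esub> c2 i \<in> A"
      using that[unfolded L_def] Ac rb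
    proof (induction rule: R.ideal_mult_induct)
      case zero
      then show ?case using AE by simp
    next
      case (step s r p)
      then obtain j where p: "p = b' j" by blast
      have rc: "r \<in> carrier R" using step Ac by blast
      have "(s \<oplus>\<^bsub>R\<^esub> r \<otimes>\<^bsub>R\<^esub> p) \<otimes>\<^bsub>R\<^esub> c2 i = s \<otimes>\<^bsub>R\<^esub> c2 i \<oplus>\<^bsub>R\<^esub> r \<otimes>\<^bsub>R\<^esub> (c2 i \<otimes>\<^bsub>R\<^esub> b' j)"
        unfolding p using step(1) rc c2c[of i] b'c[of j] by algebra
      then show ?case using step cb AE(6,7) by simp
    qed
    then show ?thesis ..
  qed
  have st: "s \<otimes>\<^bsub>R\<^esub> t \<in> A" if s: "s \<in> L" and "t \<in> L'" for s t
  proof -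
    have "t \<in> carrier R \<and> s \<otimes>\<^bsub>R\<^esub> t \<in> A"
      using that(2)[unfolded L'_def] Ac rc
    proof (induction rule: R.ideal_mult_induct)
      case zero
      then show ?case using s Lc AE by (auto simp: subset_iff)
    next
      case (step t r p)
      then obtain i where p: "p = c2 i" by blast
      have c: "r \<in> carrier R" "s \<in> carrier R" using step Ac s Lc by auto
      have "s \<otimes>\<^bsub>R\<^esub> (t \<oplus>\<^bsub>R\<^esub> r \<otimes>\<^bsub>R\<^esub> p) = s \<otimes>\<^bsub>R\<^esub> t \<oplus>\<^bsub>R\<^esub> r \<otimes>\<^bsub>R\<^esub> (s \<otimes>\<^bsub>R\<^esub> c2 i)"
        unfolding p using step(1) c c2c[of i] by algebra
      then show ?case using step sc[OF s] AE(6,7) by simp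
    qed
    then show ?thesis ..
  qed
  have LL': "ideal_mult R L L' = A"
  proof
    show "ideal_mult R L L' \<subseteq> A"
      by (rule R.ideal_mult_subset[OF Lc L'c R.submod_subring[OF A] st])
    note LL = R.submod_ideal_mult[OF Ac L L'c]
    have "finsum R (\<lambda>i. b' i \<otimes>\<^bsub>R\<^esub> c2 i) {..<n} \<in> ideal_mult R L L'"
      by (intro R.submod_finsum[OF LL] R.ideal_mult_mem[OF Lc L'c] b'L c2L) simp
    then have "\<one>\<^bsub>R\<^esub> \<in> ideal_mult R L L'" using b'c2 by simp
    then show "A \<subseteq> ideal_mult R L L'"
      using R.submodD(4)[OF LL, of _ "\<one>\<^bsub>R\<^esub>"] Ac by (auto simp: subset_iff)
  qed
  have hL: "h ` L = ideal_mult S (h ` A) (range x)"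
    unfolding L_def image_ideal_mult[OF Ac rb] by (simp add: image_image hb')
  have "h ` L = J"
  proof
    have Bc: "h ` A \<subseteq> carrier S" and rx: "range x \<subseteq> carrier S" using Ac by auto
    show "h ` L \<subseteq> J"
      unfolding hL by (rule S.ideal_mult_subset[OF Bc rx J]) (use S.submodD(4)[OF J] xJ in auto)
    show "J \<subseteq> h ` L"
    proof
      fix z assume z: "z \<in> J"
      then have zc: "z \<in> carrier S" using Jc by blast
      \<comment> \<open>Multiplying \<open>z\<close> by the sum of the \<open>x k y k\<close> writes
        it as a combination of the \<open>x k\<close> with coefficients \<open>z y k\<close> in
        \<open>JJ' = h(A)\<close>; thus the \<open>x k\<close> generate \<open>J\<close>.\<close>
      have zy: "z \<otimes>\<^bsub>S\<^esub> y k \<in> h ` A" for k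
        using S.ideal_mult_mem[OF Jc J'c z yJ] J'(2) by simp
      have "z = finsum S (\<lambda>k. z \<otimes>\<^bsub>S\<^esub> x k \<otimes>\<^bsub>S\<^esub> (y k \<otimes>\<^bsub>S\<^esub> \<one>\<^bsub>S\<^esub>)) {..<n}"
        using sum_xy[OF zc S.one_closed] zc by simp
      also have "\<dots> = finsum S (\<lambda>k. z \<otimes>\<^bsub>S\<^esub> y k \<otimes>\<^bsub>S\<^esub> x k) {..<n}"
        using zc by (intro S.finsum_cong') (auto simp: S.m_ac)
      also have "\<dots> \<in> h ` L"
        using zy S.ideal_mult_mem[OF Bc rx] unfolding hL
        by (intro S.submod_finsum[OF S.submod_ideal_mult[OF Bc S.submod_subring[OF image_subring] rx]]) auto
      finally show "z \<in> h ` L" .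
    qed
  qed
  then show ?thesis using L L' LL' unfolding invertible_ideal_def by blast
qed

end

section \<open>The class group\<close>

context nil_surjection
begin

text \<open>First isomorphism theorem for the map sending \<open>L\<close> to the class of
  \<open>h(L)\<close>: it is onto because invertible ideals lift, and its kernel is the group of
  principal ideals because units both map to units and lift.\<close>

theorem class_group_iso:
  "\<exists>f \<in> iso (class_group R A) (class_group S (h ` A)).
     \<forall>L. invertible_ideal R A L \<longrightarrow> f (ideal_class R A L) = ideal_class S (h ` A) (h ` L)"
proof -
  note B = image_subring
  let ?G = "inv_ideal_group R A" and ?H = "inv_ideal_group S (h ` A)"
  let ?P = "principal_ideals R A" and ?Q = "principal_ideals S (h ` A)"
  let ?C = "class_group S (h ` A)"
  interpret G: comm_group ?G by (rule R.inv_ideal_comm_group[OF A])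
  interpret H: comm_group ?H by (rule S.inv_ideal_comm_group[OF B])
  interpret P: normal ?P ?G by (rule R.principal_normal[OF A])
  interpret Q: normal ?Q ?H by (rule S.principal_normal[OF B])
  have G: "L \<in> carrier ?G \<longleftrightarrow> invertible_ideal R A L" for L by (simp add: inv_ideal_group_def)
  have H: "J \<in> carrier ?H \<longleftrightarrow> invertible_ideal S (h ` A) J" for J by (simp add: inv_ideal_group_def)
  have Lc: "L \<subseteq> carrier R" if "L \<in> carrier ?G" for L
    using that R.submodD(1) unfolding G invertible_ideal_def by blast
  have hom: "(\<lambda>L. h ` L) \<in> hom ?G ?H"
  proof (rule homI)
    show "h ` L \<in> carrier ?H" if "L \<in> carrier ?G" for L
      using that invertible_image unfolding G H by blast
    show "h ` (L \<otimes>\<^bsub>?G\<^esub> M) = h ` L \<otimes>\<^bsub>?H\<^esub> h ` M" if "L \<in> carrier ?G" "M \<in> carrier ?G" for L M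
      using image_ideal_mult[OF Lc[OF that(1)] Lc[OF that(2)]] by (simp add: inv_ideal_group_def)
  qed
  define k where "k L = ideal_class S (h ` A) (h ` L)" for L
  have k_comp: "k = (\<lambda>J. ?Q #>\<^bsub>?H\<^esub> J) \<circ> (\<lambda>L. h ` L)"
    by (simp add: fun_eq_iff k_def ideal_class_def)
  have "k \<in> hom ?G ?C"
    unfolding k_comp class_group_def by (rule hom_compose[OF hom Q.r_coset_hom_Mod])
  then interpret k: group_hom ?G ?C k
    by (intro group_hom.intro group_hom_axioms.intro G.is_group)
      (simp_all add: class_group_def Q.factorgroup_is_group)
  have "k ` carrier ?G = carrier ?C"
  proof -
    have "(\<lambda>L. h ` L) ` carrier ?G = carrier ?H"
    proof
      show "(\<lambda>L. h ` L) ` carrier ?G \<subseteq> carrier ?H" using hom by (auto simp: hom_def)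
      show "carrier ?H \<subseteq> (\<lambda>L. h ` L) ` carrier ?G"
      proof
        fix J assume "J \<in> carrier ?H"
        then obtain L where "invertible_ideal R A L" "h ` L = J"
          unfolding H by (blast dest: invertible_ideal_lift)
        then show "J \<in> (\<lambda>L. h ` L) ` carrier ?G"
          using G by blast
      qed
    qed
    then have "k ` carrier ?G = (\<lambda>J. ?Q #>\<^bsub>?H\<^esub> J) ` carrier ?H"
      unfolding k_comp image_comp[symmetric] by simp
    also have "\<dots> = carrier ?C"
      unfolding class_group_def FactGroup_def RCOSETS_def by auto
    finally show ?thesis .
  qed
  moreover have "kernel ?G ?C k = ?P"
  proof -
    have "k L = \<one>\<^bsub>?C\<^esub> \<longleftrightarrow> L \<in> ?P" if L: "L \<in> carrier ?G" for L
    proof -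
      have hL: "h ` L \<in> carrier ?H" using L invertible_image unfolding G H by blast
      have "k L = \<one>\<^bsub>?C\<^esub> \<longleftrightarrow> ?Q #>\<^bsub>?H\<^esub> h ` L = ?Q"
        unfolding k_def ideal_class_def class_group_def FactGroup_def by simp
      also have "\<dots> \<longleftrightarrow> h ` L \<in> ?Q"
        by (rule iffI[OF H.coset_join1[OF _ hL Q.subgroup_axioms] H.coset_join2[OF hL Q.subgroup_axioms]])
      also have "\<dots> \<longleftrightarrow> L \<in> ?P"
      proof
        assume "h ` L \<in> ?Q"
        then obtain y where y: "y \<in> Units S" "h ` L = (\<lambda>a. a \<otimes>\<^bsub>S\<^esub> y) ` h ` A"
          unfolding principal_ideals_def by blast
        show "L \<in> ?P"
          using principal_lift[OF L[unfolded G] y] unfolding principal_ideals_def by blast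
      next
        assume "L \<in> ?P"
        then obtain x where x: "x \<in> Units R" "L = (\<lambda>a. a \<otimes>\<^bsub>R\<^esub> x) ` A"
          unfolding principal_ideals_def by blast
        have "h ` L = (\<lambda>a. a \<otimes>\<^bsub>S\<^esub> h x) ` h ` A"
          unfolding x(2) by (rule image_principal[OF R.Units_closed[OF x(1)]])
        then show "h ` L \<in> ?Q"
          using unit_image[OF x(1)] unfolding principal_ideals_def by blast
      qed
      finally show ?thesis .
    qed
    then show ?thesis using P.subset unfolding kernel_def by blast
  qed
  ultimately have iso: "(\<lambda>U. the_elem (k ` U)) \<in> iso (class_group R A) ?C"
    using k.FactGroup_iso_set by (simp add: class_group_def[of R A])
  \<comment> \<open>The induced map reads off the single value of \<open>k\<close> on a coset, so
    \<open>k\<close> must be seen to be constant on the class of \<open>L\<close>; elements of that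
    class differ by a factor in the kernel.\<close>
  have "the_elem (k ` ideal_class R A L) = k L" if "invertible_ideal R A L" for L
  proof -
    have L: "L \<in> carrier ?G" using that G by simp
    have "k M = k L" if M: "M \<in> ?P #>\<^bsub>?G\<^esub> L" for M
    proof -
      obtain N where N: "N \<in> ?P" "M = N \<otimes>\<^bsub>?G\<^esub> L" using M unfolding r_coset_def by blast
      then have "N \<in> carrier ?G" "k N = \<one>\<^bsub>?C\<^esub>"
        using \<open>kernel ?G ?C k = ?P\<close> unfolding kernel_def by auto
      then show ?thesis using N L k.hom_closed[OF L] by simp
    qed
    moreover have "L \<in> ?P #>\<^bsub>?G\<^esub> L" by (rule G.rcos_self[OF L P.subgroup_axioms])
    ultimately have "k ` (?P #>\<^bsub>?G\<^esub> L) = {k L}" by blast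
    then show ?thesis unfolding ideal_class_def by simp
  qed
  then show ?thesis
    by (intro bexI[OF _ iso]) (simp add: k_def)
qed

end

section \<open>Passage to the reduced ring\<close>

lemma (in cring) red_surjection:
  assumes A: "subring A R"
  shows "nil_surjection R (red R) (red_map R) A"
proof -
  interpret I: ideal "nilradical R" R by (rule nilradical_ideal)
  have map: "red_map R = (+>) (nilradical R)" by (simp add: red_map_def fun_eq_iff)
  interpret ring_hom_cring R "red R" "red_map R"
    unfolding map red_def by (rule I.rcos_ring_hom_cring[OF is_cring])
  show ?thesis
  proof (intro nil_surjection.intro nil_surjection_axioms.intro ring_hom_cring_axioms A)
    show "red_map R ` carrier R = carrier (red R)"
      unfolding map red_def FactRing_def A_RCOSETS_def' by auto
    fix x assume x: "x \<in> carrier R" "red_map R x = \<zero>\<^bsub>red R\<^esub>"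
    then have "nilradical R +> x = nilradical R" unfolding map red_def FactRing_def by simp
    then show "x \<in> nilradical R" using I.rcos_const_imp_mem x(1) by blast
  qed
qed

theorem theorem5p5:
  fixes R :: "('a, 'b) ring_scheme" and A :: "'a set"
  assumes "cring R" and "subring A R"
  shows "\<exists>h \<in> iso (class_group R A) (class_group (red R) (red_map R ` A)).
           \<forall>L. invertible_ideal R A L \<longrightarrow>
              invertible_ideal (red R) (red_map R ` A)
                 (ideal_mult (red R) (red_map R ` L) (red_map R ` A))
            \<and> h (ideal_class R A L) =
                ideal_class (red R) (red_map R ` A)
                  (ideal_mult (red R) (red_map R ` L) (red_map R ` A))"
proof -
  interpret cring R by fact
  interpret nil_surjection R "red R" "red_map R" A by (rule red_surjection[OF assms(2)])
  \<comment> \<open>The image of \<open>L\<close> is already a module over the image of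
    \<open>A\<close>, so multiplying by that subring changes nothing and the extended ideal is
    simply the image.\<close>
  have "invertible_ideal (red R) (red_map R ` A) (red_map R ` L)
      \<and> ideal_mult (red R) (red_map R ` L) (red_map R ` A) = red_map R ` L"
    if L: "invertible_ideal R A L" for L
  proof -
    have "submod (red R) (red_map R ` A) (red_map R ` L)"
      using L submod_image unfolding invertible_ideal_def by blast
    then show ?thesis using S.ideal_mult_one(1)[OF image_subring] invertible_image[OF L] by blast
  qed
  then show ?thesis using class_group_iso by simp
qed

end
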